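(* Let $X,Y$ be complex Banach spaces such that $Y$ has the bounded approximation property. Let $\phi\in\mathcal{H}L_0(B_Y,X)$ with $\phi(B_Y)\subseteq B_X$. Then the following assertions are equivalent. (1) $C_\phi\colon\mathcal{H}L_0(B_X)\to\mathcal{H}L_0(B_Y)$ is an onto isometry. (2) $C_\phi\colon\mathcal{H}L_0(B_X)\to\mathcal{H}L_0(B_Y)$ is an onto isomorphism. (3) $\phi\colon B_Y\to B_X$ is a bijection and $\phi^{-1}\in\mathcal{H}L_0(B_X,Y)$. (4) $\phi$ is the restriction to $B_Y$ of an onto linear isometry $T\colon Y\to X$.
   Context: $B_X$ denotes the open unit ball of $X$. For complex Banach spaces $X,Y$, $\mathcal{H}L_0(B_X,Y)$ is the Banach space of all holomorphic Lipschitz maps $f\colon B_X\to Y$ with $f(0)=0$, normed by the Lipschitz constant $L(f)$; $\mathcal{H}L_0(B_X)=\mathcal{H}L_0(B_X,\mathbb C)$. For $\phi\in\mathcal{H}L_0(B_Y,X)$ with $\phi(B_Y)\subseteq B_X$, the composition operator $C_\phi\colon\mathcal{H}L_0(B_X)\to\mathcal{H}L_0(B_Y)$ is the bounded linear operator $C_\phi(f)=f\circ\phi$. "Isomorphism" means linear homeomorphism. A Banach space $Y$ has the bounded approximation property if there is $\lambda>0$ such that the identity of $Y$ can be approximated, uniformly on compact sets, by finite-rank operators of norm at most $\lambda$. *)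

theory Defs
  imports "HOL-Analysis.Analysis"
begin

section \<open>Complex normed and Banach spaces\<close>

class complex_normed_vector = real_normed_vector +
  fixes scaleC :: "complex \<Rightarrow> 'a \<Rightarrow> 'a" (infixr \<open>*\<^sub>C\<close> 75)
  assumes scaleC_add_right: "a *\<^sub>C (x + y) = a *\<^sub>C x + a *\<^sub>C y"
    and scaleC_add_left: "(a + b) *\<^sub>C x = a *\<^sub>C x + b *\<^sub>C x"
    and scaleC_scaleC: "a *\<^sub>C b *\<^sub>C x = (a * b) *\<^sub>C x"
    and scaleC_complex_of_real: "complex_of_real r *\<^sub>C x = r *\<^sub>R x"
    and norm_scaleC: "norm (a *\<^sub>C x) = cmod a * norm x"

class complex_banach = complex_normed_vector + banach

global_interpretation complex_vector:
  vector_space "scaleC :: complex \<Rightarrow> 'a \<Rightarrow> 'a::complex_normed_vector"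
  defines cspan = complex_vector.span
proof unfold_locales
  fix x :: 'a
  show "1 *\<^sub>C x = x"
    using scaleC_complex_of_real[of 1 x] by simp
qed (simp_all add: scaleC_add_right scaleC_add_left scaleC_scaleC)

abbreviation clinear :: "('a::complex_normed_vector \<Rightarrow> 'b::complex_normed_vector) \<Rightarrow> bool"
  where "clinear \<equiv> Vector_Spaces.linear scaleC scaleC"

instantiation complex :: complex_banach
begin

definition scaleC_complex :: "complex \<Rightarrow> complex \<Rightarrow> complex"
  where "scaleC_complex a x = a * x"

instance
  by standard (simp_all add: scaleC_complex_def algebra_simps norm_mult scaleR_conv_of_real)

end

lemma clinear_iff:
  fixes f :: "'a::complex_normed_vector \<Rightarrow> 'b::complex_normed_vector"
  shows "clinear f \<longleftrightarrow> (\<forall>x y. f (x + y) = f x + f y) \<and> (\<forall>c x. f (c *\<^sub>C x) = c *\<^sub>C f x)"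
  by (simp add: Vector_Spaces.linear_iff complex_vector.vector_space_axioms)

lemma bounded_linear_scaleC_right:
  "bounded_linear (\<lambda>x::'a::complex_normed_vector. c *\<^sub>C x)"
proof (rule bounded_linear_intro[where K = "cmod c"])
  fix r :: real and x :: 'a
  show "c *\<^sub>C (r *\<^sub>R x) = r *\<^sub>R (c *\<^sub>C x)"
    by (simp flip: scaleC_complex_of_real add: scaleC_scaleC mult.commute)
qed (simp_all add: scaleC_add_right norm_scaleC mult.commute)

definition onto_linear_isometry :: "('a::complex_normed_vector \<Rightarrow> 'b::complex_normed_vector) \<Rightarrow> bool"
  where "onto_linear_isometry T \<longleftrightarrow> clinear T \<and> (\<forall>x. norm (T x) = norm x) \<and> surj T"

definition onto_isomorphism :: "('a::complex_normed_vector \<Rightarrow> 'b::complex_normed_vector) \<Rightarrow> bool"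
  where "onto_isomorphism T \<longleftrightarrow> clinear T \<and> (\<exists>S. homeomorphism UNIV UNIV T S)"

definition finite_rank_operator :: "('a::complex_normed_vector \<Rightarrow> 'b::complex_normed_vector) \<Rightarrow> bool"
  where "finite_rank_operator T \<longleftrightarrow>
    bounded_linear T \<and> clinear T \<and> (\<exists>B. finite B \<and> range T \<subseteq> cspan B)"

text \<open>The argument only serves to name the space by its type.\<close>

definition bounded_approximation_property :: "'a::complex_normed_vector itself \<Rightarrow> bool"
  where "bounded_approximation_property _ \<longleftrightarrow>
    (\<exists>c>0. \<forall>K::'a set. compact K \<longrightarrow>
      (\<forall>e>0. \<exists>T. finite_rank_operator T \<and> onorm T \<le> c \<and> (\<forall>x\<in>K. norm (T x - x) < e)))"


section \<open>Holomorphic Lipschitz maps on the open unit ball\<close>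

text \<open>Holomorphy between complex normed spaces is complex Frechet differentiability
  (boundedness of the derivative is part of \<^const>\<open>has_derivative\<close>).\<close>

definition cholomorphic_on ::
    "('a::complex_normed_vector \<Rightarrow> 'b::complex_normed_vector) \<Rightarrow> 'a set \<Rightarrow> bool"
  (infixl \<open>cholomorphic'_on\<close> 50)
  where "f cholomorphic_on S \<longleftrightarrow>
    (\<forall>x\<in>S. \<exists>D. clinear D \<and> (f has_derivative D) (at x within S))"

text \<open>The infimum is attained, see \<open>lipschitz_on_lipschitz_const\<close> below; as
  \<^const>\<open>lipschitz_on\<close> only admits nonnegative constants, it is also the right value
  when the ball is a single point.\<close>

definition lipschitz_const :: "('a::real_normed_vector \<Rightarrow> 'b::real_normed_vector) \<Rightarrow> real"
  where "lipschitz_const f = Inf {C. C-lipschitz_on (ball 0 1) f}"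

text \<open>HOL functions are total, so a map on the open unit ball is represented by its extension
  by \<open>0\<close>. This makes the representation unique and compatible with the vector space operations.\<close>

definition HL0_set :: "('a::complex_normed_vector \<Rightarrow> 'b::complex_normed_vector) set"
  where "HL0_set = {f. f cholomorphic_on ball 0 1 \<and> (\<exists>C. C-lipschitz_on (ball 0 1) f) \<and>
    f 0 = 0 \<and> (\<forall>x. x \<notin> ball 0 1 \<longrightarrow> f x = 0)}"

lemma lipschitz_const_nonneg: "\<exists>C. C-lipschitz_on (ball 0 1) f \<Longrightarrow> 0 \<le> lipschitz_const f"
  unfolding lipschitz_const_def by (rule cInf_greatest) (auto simp: lipschitz_on_nonneg)

lemma lipschitz_const_le:
  assumes "C-lipschitz_on (ball 0 1) f"
  shows "lipschitz_const f \<le> C"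
  unfolding lipschitz_const_def
proof (rule cInf_lower)
  show "bdd_below {C. C-lipschitz_on (ball 0 1) f}"
    by (rule bdd_belowI[of _ 0]) (auto simp: lipschitz_on_nonneg)
qed (use assms in simp)

lemma lipschitz_on_lipschitz_const:
  assumes "\<exists>C. C-lipschitz_on (ball 0 1) f"
  shows "(lipschitz_const f)-lipschitz_on (ball 0 1) f"
proof (rule lipschitz_onI)
  fix x y :: 'a
  assume xy: "x \<in> ball 0 1" "y \<in> ball 0 1"
  show "dist (f x) (f y) \<le> lipschitz_const f * dist x y"
  proof (cases "x = y")
    case False
    have "dist (f x) (f y) / dist x y \<le> lipschitz_const f"
      unfolding lipschitz_const_def
    proof (rule cInf_greatest)
      fix C assume "C \<in> {C. C-lipschitz_on (ball 0 1) f}"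
      then show "dist (f x) (f y) / dist x y \<le> C"
        using xy False lipschitz_onD[of C "ball 0 1" f x y] by (simp add: divide_le_eq)
    qed (use assms in auto)
    then show ?thesis
      using False by (simp add: divide_le_eq)
  qed simp
qed (rule lipschitz_const_nonneg[OF assms])

lemma HL0_set_zero: "(\<lambda>_. 0) \<in> HL0_set"
proof -
  have "(\<lambda>x::'a. 0::'b) cholomorphic_on ball 0 1"
    unfolding cholomorphic_on_def by (auto intro!: exI[of _ "\<lambda>_. 0"] simp: clinear_iff)
  moreover have "0-lipschitz_on (ball 0 1) (\<lambda>x::'a. 0::'b)"
    by (rule lipschitz_on_constant)
  ultimately show ?thesis
    unfolding HL0_set_def by blast
qed

typedef (overloaded) ('a, 'b) hl0 =
  "HL0_set :: ('a::complex_normed_vector \<Rightarrow> 'b::complex_normed_vector) set"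
  morphisms hl0_apply Abs_hl0
  using HL0_set_zero by blast

setup_lifting type_definition_hl0

lemma cholomorphic_on_add:
  assumes "f cholomorphic_on S" "g cholomorphic_on S"
  shows "(\<lambda>x. f x + g x) cholomorphic_on S"
  unfolding cholomorphic_on_def
proof
  fix x assume "x \<in> S"
  then obtain D E where "clinear D" "(f has_derivative D) (at x within S)"
    "clinear E" "(g has_derivative E) (at x within S)"
    using assms unfolding cholomorphic_on_def by blast
  then show "\<exists>D. clinear D \<and> ((\<lambda>x. f x + g x) has_derivative D) (at x within S)"
    by (intro exI[of _ "\<lambda>h. D h + E h"])
       (auto intro!: has_derivative_add simp: clinear_iff complex_vector.scale_right_distrib)
qed

lemma cholomorphic_on_scaleC:
  assumes "f cholomorphic_on S"
  shows "(\<lambda>x. c *\<^sub>C f x) cholomorphic_on S"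
  unfolding cholomorphic_on_def
proof
  fix x assume "x \<in> S"
  then obtain D where D: "clinear D" "(f has_derivative D) (at x within S)"
    using assms unfolding cholomorphic_on_def by blast
  have "((\<lambda>x. c *\<^sub>C f x) has_derivative (\<lambda>h. c *\<^sub>C D h)) (at x within S)"
    by (rule bounded_linear.has_derivative[OF bounded_linear_scaleC_right D(2)])
  moreover have "clinear (\<lambda>h. c *\<^sub>C D h)"
    using D(1) by (auto simp: clinear_iff complex_vector.scale_right_distrib mult.commute)
  ultimately show "\<exists>D. clinear D \<and> ((\<lambda>x. c *\<^sub>C f x) has_derivative D) (at x within S)"
    by blast
qed

lemma lipschitz_on_scaleC:
  fixes f :: "'a::metric_space \<Rightarrow> 'b::complex_normed_vector"
  assumes "C-lipschitz_on S f"
  shows "(cmod c * C)-lipschitz_on S (\<lambda>x. c *\<^sub>C f x)"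
proof (rule lipschitz_onI)
  fix x y assume "x \<in> S" "y \<in> S"
  then have "norm (f x - f y) \<le> C * dist x y"
    using lipschitz_onD[OF assms] by (simp add: dist_norm)
  then show "dist (c *\<^sub>C f x) (c *\<^sub>C f y) \<le> cmod c * C * dist x y"
    by (simp add: dist_norm norm_scaleC mult.assoc mult_left_mono
        flip: complex_vector.scale_right_diff_distrib)
qed (use lipschitz_on_nonneg[OF assms] in simp)

lemma HL0_set_add: "f \<in> HL0_set \<Longrightarrow> g \<in> HL0_set \<Longrightarrow> (\<lambda>x. f x + g x) \<in> HL0_set"
  unfolding HL0_set_def by (auto intro: cholomorphic_on_add lipschitz_on_add)

lemma HL0_set_scaleC: "f \<in> HL0_set \<Longrightarrow> (\<lambda>x. c *\<^sub>C f x) \<in> HL0_set"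
  unfolding HL0_set_def by (auto intro: cholomorphic_on_scaleC lipschitz_on_scaleC)

lemma HL0_set_scaleR: "f \<in> HL0_set \<Longrightarrow> (\<lambda>x. r *\<^sub>R f x) \<in> HL0_set"
  using HL0_set_scaleC[of f "complex_of_real r"] by (simp add: scaleC_complex_of_real)

lemma HL0_set_minus: "f \<in> HL0_set \<Longrightarrow> (\<lambda>x. - f x) \<in> HL0_set"
  using HL0_set_scaleR[of f "-1"] by simp

lemma HL0_set_diff: "f \<in> HL0_set \<Longrightarrow> g \<in> HL0_set \<Longrightarrow> (\<lambda>x. f x - g x) \<in> HL0_set"
  using HL0_set_add[of f "\<lambda>x. - g x"] HL0_set_minus by auto

lemma HL0_set_lipschitz: "f \<in> HL0_set \<Longrightarrow> (lipschitz_const f)-lipschitz_on (ball 0 1) f"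
  unfolding HL0_set_def by (auto intro: lipschitz_on_lipschitz_const)

lemma HL0_set_const_eq_0:
  assumes f: "f \<in> HL0_set"
  shows "lipschitz_const f = 0 \<longleftrightarrow> f = (\<lambda>_. 0)"
proof
  assume "lipschitz_const f = 0"
  then have "f x = f 0" if "x \<in> ball 0 1" for x
    using lipschitz_onD[OF HL0_set_lipschitz[OF f] that, of 0] by simp
  then show "f = (\<lambda>_. 0)"
    using f unfolding HL0_set_def by (intro ext) (metis (mono_tags, lifting) mem_Collect_eq)
next
  assume "f = (\<lambda>_. 0)"
  then show "lipschitz_const f = 0"
    using lipschitz_const_le[OF lipschitz_on_constant, of "0::'b"]
      lipschitz_on_nonneg[OF HL0_set_lipschitz[OF f]] by (metis order_antisym)
qed

lemma lipschitz_const_scaleC_le: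
  assumes "f \<in> HL0_set"
  shows "lipschitz_const (\<lambda>x. c *\<^sub>C f x) \<le> cmod c * lipschitz_const f"
  by (rule lipschitz_const_le[OF lipschitz_on_scaleC[OF HL0_set_lipschitz[OF assms]]])

lemma lipschitz_const_scaleC:
  assumes f: "f \<in> HL0_set"
  shows "lipschitz_const (\<lambda>x. c *\<^sub>C f x) = cmod c * lipschitz_const f"
proof (cases "c = 0")
  case True
  then show ?thesis
    using HL0_set_const_eq_0[OF HL0_set_zero] by simp
next
  case False
  have "lipschitz_const (\<lambda>x. inverse c *\<^sub>C c *\<^sub>C f x)
      \<le> cmod (inverse c) * lipschitz_const (\<lambda>x. c *\<^sub>C f x)"
    by (rule lipschitz_const_scaleC_le[OF HL0_set_scaleC[OF f]])
  then have "cmod c * lipschitz_const f \<le> lipschitz_const (\<lambda>x. c *\<^sub>C f x)"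
    using False by (simp add: norm_divide field_simps)
  then show ?thesis
    using lipschitz_const_scaleC_le[OF f] by (simp add: order_antisym)
qed

lemma lipschitz_const_scaleR:
  "f \<in> HL0_set \<Longrightarrow> lipschitz_const (\<lambda>x. r *\<^sub>R f x) = \<bar>r\<bar> * lipschitz_const f"
  using lipschitz_const_scaleC[of f "complex_of_real r"] by (simp add: scaleC_complex_of_real)

lemma lipschitz_const_triangle:
  "f \<in> HL0_set \<Longrightarrow> g \<in> HL0_set \<Longrightarrow>
    lipschitz_const (\<lambda>x. f x + g x) \<le> lipschitz_const f + lipschitz_const g"
  by (intro lipschitz_const_le lipschitz_on_add HL0_set_lipschitz)

instantiation hl0 :: (complex_normed_vector, complex_normed_vector) complex_normed_vector
begin

lift_definition norm_hl0 :: "('a, 'b) hl0 \<Rightarrow> real" is lipschitz_const .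

lift_definition zero_hl0 :: "('a, 'b) hl0" is "\<lambda>_. 0"
  by (rule HL0_set_zero)

lift_definition plus_hl0 :: "('a, 'b) hl0 \<Rightarrow> ('a, 'b) hl0 \<Rightarrow> ('a, 'b) hl0"
  is "\<lambda>f g x. f x + g x" by (rule HL0_set_add)

lift_definition minus_hl0 :: "('a, 'b) hl0 \<Rightarrow> ('a, 'b) hl0 \<Rightarrow> ('a, 'b) hl0"
  is "\<lambda>f g x. f x - g x" by (rule HL0_set_diff)

lift_definition uminus_hl0 :: "('a, 'b) hl0 \<Rightarrow> ('a, 'b) hl0"
  is "\<lambda>f x. - f x" by (rule HL0_set_minus)

lift_definition scaleR_hl0 :: "real \<Rightarrow> ('a, 'b) hl0 \<Rightarrow> ('a, 'b) hl0"
  is "\<lambda>r f x. r *\<^sub>R f x" by (rule HL0_set_scaleR)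

lift_definition scaleC_hl0 :: "complex \<Rightarrow> ('a, 'b) hl0 \<Rightarrow> ('a, 'b) hl0"
  is "\<lambda>c f x. c *\<^sub>C f x" by (rule HL0_set_scaleC)

definition sgn_hl0 :: "('a, 'b) hl0 \<Rightarrow> ('a, 'b) hl0"
  where "sgn_hl0 f = scaleR (inverse (norm f)) f"

definition dist_hl0 :: "('a, 'b) hl0 \<Rightarrow> ('a, 'b) hl0 \<Rightarrow> real"
  where "dist_hl0 f g = norm (f - g)"

definition [code del]:
  "(uniformity :: (('a, 'b) hl0 \<times> ('a, 'b) hl0) filter) =
    (INF e\<in>{0 <..}. principal {(x, y). dist x y < e})"

definition open_hl0 :: "('a, 'b) hl0 set \<Rightarrow> bool"
  where [code del]: "open_hl0 S = (\<forall>x\<in>S. \<forall>\<^sub>F (x', y) in uniformity. x' = x \<longrightarrow> y \<in> S)"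

instance
proof
  fix f g h :: "('a, 'b) hl0" and r s :: real and a b :: complex and S :: "('a, 'b) hl0 set"
  show "f + g + h = f + (g + h)" "f + g = g + f" "0 + f = f" "- f + f = 0" "f - g = f + - g"
    by (transfer; simp add: add_ac)+
  show "r *\<^sub>R (f + g) = r *\<^sub>R f + r *\<^sub>R g" "(r + s) *\<^sub>R f = r *\<^sub>R f + s *\<^sub>R f"
    "r *\<^sub>R s *\<^sub>R f = (r * s) *\<^sub>R f" "1 *\<^sub>R f = f"
    by (transfer; simp add: algebra_simps)+
  show "a *\<^sub>C (f + g) = a *\<^sub>C f + a *\<^sub>C g" "(a + b) *\<^sub>C f = a *\<^sub>C f + b *\<^sub>C f"
    "a *\<^sub>C b *\<^sub>C f = (a * b) *\<^sub>C f" "complex_of_real r *\<^sub>C f = r *\<^sub>R f"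
    by (transfer; simp add: scaleC_add_right scaleC_add_left scaleC_scaleC scaleC_complex_of_real)+
  show "dist f g = norm (f - g)" "sgn f = scaleR (inverse (norm f)) f"
    by (simp_all add: dist_hl0_def sgn_hl0_def)
  show "(uniformity :: (('a, 'b) hl0 \<times> ('a, 'b) hl0) filter) =
    (INF e\<in>{0 <..}. principal {(x, y). dist x y < e})"
    by (rule uniformity_hl0_def)
  show "open S = (\<forall>x\<in>S. \<forall>\<^sub>F (x', y) in uniformity. x' = x \<longrightarrow> y \<in> S)"
    by (rule open_hl0_def)
  show "norm f = 0 \<longleftrightarrow> f = 0"
    by (transfer; rule HL0_set_const_eq_0)
  show "norm (f + g) \<le> norm f + norm g"
    by (transfer; rule lipschitz_const_triangle)
  show "norm (r *\<^sub>R f) = \<bar>r\<bar> * norm f"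
    by (transfer; rule lipschitz_const_scaleR)
  show "norm (a *\<^sub>C f) = cmod a * norm f"
    by (transfer; rule lipschitz_const_scaleC)
qed

end

lemma lipschitz_on_hl0_apply: "(norm f)-lipschitz_on (ball 0 1) (hl0_apply f)"
  by transfer (rule HL0_set_lipschitz)

lemma has_derivative_lipschitz_bound:
  fixes f :: "'a::real_normed_vector \<Rightarrow> 'b::real_normed_vector"
  assumes "C-lipschitz_on S f" "open S" "x \<in> S" "(f has_derivative D) (at x)"
  shows "norm (D h) \<le> C * norm h"
proof (rule field_le_epsilon)
  fix e :: real assume e: "e > 0"
  define e' where "e' = e / (norm h + 1)"
  have pos: "norm h + 1 > 0"
    by (simp add: add_nonneg_pos)
  then have e': "e' > 0" "e' * norm h \<le> e"
    using e by (simp_all add: e'_def divide_le_eq)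
  obtain d where d: "d > 0"
    "\<And>y. norm (y - x) < d \<Longrightarrow> norm (f y - f x - D (y - x)) \<le> e' * norm (y - x)"
    using assms(4) e'(1) unfolding has_derivative_at_alt by blast
  obtain r where r: "r > 0" "ball x r \<subseteq> S"
    using assms(2,3) by (meson openE)
  define t where "t = min d r / (norm h + 1)"
  have t: "t > 0"
    using d(1) r(1) by (simp add: t_def add_nonneg_pos)
  have "t * norm h < t * (norm h + 1)"
    using t by simp
  also have "\<dots> = min d r"
    using pos by (simp add: t_def)
  finally have th: "norm (t *\<^sub>R h) < d" "norm (t *\<^sub>R h) < r"
    using t by auto
  have "x + t *\<^sub>R h \<in> S"
    using r(2) th(2) by (auto simp: dist_norm)
  then have "norm (f (x + t *\<^sub>R h) - f x) \<le> C * norm (t *\<^sub>R h)"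
    using lipschitz_onD[OF assms(1) _ assms(3), of "x + t *\<^sub>R h"] by (simp add: dist_norm)
  moreover have "norm (f (x + t *\<^sub>R h) - f x - D (t *\<^sub>R h)) \<le> e' * norm (t *\<^sub>R h)"
    using d(2)[of "x + t *\<^sub>R h"] th(1) by simp
  moreover have "norm (D (t *\<^sub>R h)) \<le> norm (f (x + t *\<^sub>R h) - f x)
      + norm (f (x + t *\<^sub>R h) - f x - D (t *\<^sub>R h))"
    by (metis norm_triangle_sub norm_minus_commute add.commute)
  ultimately have "norm (D (t *\<^sub>R h)) \<le> (C + e') * norm (t *\<^sub>R h)"
    by (simp add: algebra_simps)
  then have "t * norm (D h) \<le> t * ((C + e') * norm h)"
    using t by (simp add: linear_scale[OF has_derivative_linear[OF assms(4)]] algebra_simps)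
  then have "norm (D h) \<le> (C + e') * norm h"
    using t by simp
  then show "norm (D h) \<le> C * norm h + e"
    using e'(2) by (simp add: algebra_simps)
qed

lemma hl0_apply_eq_0: "x \<notin> ball 0 1 \<Longrightarrow> hl0_apply f x = 0"
  using hl0_apply[of f] unfolding HL0_set_def by blast

lemma hl0_apply_0: "hl0_apply f 0 = 0"
  using hl0_apply[of f] unfolding HL0_set_def by blast

lemma hl0_apply_has_derivative:
  assumes "x \<in> ball 0 1"
  obtains D where "clinear D" "(hl0_apply f has_derivative D) (at x)"
proof -
  have "hl0_apply f cholomorphic_on ball 0 1"
    using hl0_apply[of f] unfolding HL0_set_def by blast
  then obtain D where "clinear D" "(hl0_apply f has_derivative D) (at x within ball 0 1)"
    using assms unfolding cholomorphic_on_def by blast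
  then show thesis
    using that assms at_within_open[OF assms open_ball] by metis
qed

instance hl0 :: (complex_normed_vector, complex_banach) complex_banach
proof
  fix X :: "nat \<Rightarrow> ('a, 'b) hl0"
  assume X: "Cauchy X"
  let ?B = "ball (0::'a) 1"
  define F where "F n = hl0_apply (X n)" for n
  have lip: "(norm (X m - X n))-lipschitz_on ?B (\<lambda>x. F m x - F n x)" for m n
    using lipschitz_on_hl0_apply[of "X m - X n"] unfolding F_def minus_hl0.rep_eq .
  define D where "D n x = (SOME D. clinear D \<and> (F n has_derivative D) (at x))" for n x
  have D: "clinear (D n x)" "(F n has_derivative D n x) (at x)" if "x \<in> ?B" for n x
  proof -
    have "\<exists>D. clinear D \<and> (F n has_derivative D) (at x)"
      unfolding F_def using hl0_apply_has_derivative[OF that] by metis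
    from someI_ex[OF this] show "clinear (D n x)" "(F n has_derivative D n x) (at x)"
      unfolding D_def by blast+
  qed
  have DC: "norm (D m x h - D n x h) \<le> norm (X m - X n) * norm h" if "x \<in> ?B" for m n x h
    by (rule has_derivative_lipschitz_bound[OF lip open_ball that])
       (intro has_derivative_diff D that)
  have Xe: "\<exists>N. \<forall>m\<ge>N. \<forall>n\<ge>N. norm (X m - X n) \<le> e" if "e > 0" for e
    using X that unfolding Cauchy_def dist_norm by (meson less_imp_le)
  have "\<exists>l. (\<lambda>n. D n x h) \<longlonglongrightarrow> l" if x: "x \<in> ?B" for x h
  proof -
    have "Cauchy (\<lambda>n. D n x h)"
      unfolding Cauchy_def dist_norm
    proof (intro allI impI)
      fix e :: real assume e: "e > 0"
      then have "e / 2 / (norm h + 1) > 0"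
        by (simp add: add_nonneg_pos)
      from Xe[OF this] obtain N where
        N: "\<And>m n. m \<ge> N \<Longrightarrow> n \<ge> N \<Longrightarrow> norm (X m - X n) \<le> e / 2 / (norm h + 1)" by blast
      have "norm (D m x h - D n x h) < e" if "m \<ge> N" "n \<ge> N" for m n
      proof -
        have "norm (D m x h - D n x h) \<le> e / 2 / (norm h + 1) * norm h"
          using DC[OF x] N[OF that] by (meson mult_right_mono norm_ge_zero order_trans)
        also have "\<dots> \<le> e / 2 / (norm h + 1) * (norm h + 1)"
          using e by (intro mult_left_mono) auto
        also have "\<dots> = e / 2"
          by (rule nonzero_eq_divide_eq[THEN iffD1, OF _ refl]) (use norm_ge_zero[of h] in linarith)
        finally show ?thesis using e by simp
      qed
      then show "\<exists>N. \<forall>m\<ge>N. \<forall>n\<ge>N. norm (D m x h - D n x h) < e" by blast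
    qed
    then show ?thesis
      by (simp add: Cauchy_convergent_iff convergent_def)
  qed
  then obtain D' where D': "\<And>x h. x \<in> ?B \<Longrightarrow> (\<lambda>n. D n x h) \<longlonglongrightarrow> D' x h"
    by metis
  have DD': "\<forall>\<^sub>F n in sequentially. \<forall>x\<in>?B. \<forall>h. norm (D n x h - D' x h) \<le> e * norm h"
    if "e > 0" for e
  proof -
    from Xe[OF that] obtain N where
      N: "\<And>m n. m \<ge> N \<Longrightarrow> n \<ge> N \<Longrightarrow> norm (X m - X n) \<le> e" by blast
    have "norm (D n x h - D' x h) \<le> e * norm h" if "n \<ge> N" "x \<in> ?B" for n x h
    proof (rule LIMSEQ_le_const2)
      show "(\<lambda>m. norm (D n x h - D m x h)) \<longlonglongrightarrow> norm (D n x h - D' x h)"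
        by (intro tendsto_intros D' that)
      show "\<exists>M. \<forall>m\<ge>M. norm (D n x h - D m x h) \<le> e * norm h"
        using DC[OF that(2)] N[OF that(1)] by (meson mult_right_mono norm_ge_zero order_trans)
    qed
    then show ?thesis
      unfolding eventually_sequentially by blast
  qed
  have "\<exists>g. \<forall>x\<in>?B. (\<lambda>n. F n x) \<longlonglongrightarrow> g x \<and> (g has_derivative D' x) (at x within ?B)"
  proof (rule has_derivative_sequence)
    show "(F n has_derivative D n x) (at x within ?B)" if "x \<in> ?B" for n x
      using D(2)[OF that] by (rule has_derivative_at_withinI)
    show "(\<lambda>n. F n 0) \<longlonglongrightarrow> 0"
      by (simp add: F_def hl0_apply_0)
  qed (use DD' in auto)
  then obtain g where g: "\<And>x. x \<in> ?B \<Longrightarrow> (\<lambda>n. F n x) \<longlonglongrightarrow> g x"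
    "\<And>x. x \<in> ?B \<Longrightarrow> (g has_derivative D' x) (at x within ?B)"
    by blast
  define G where "G x = (if x \<in> ?B then g x else 0)" for x
  have G: "(\<lambda>n. F n x) \<longlonglongrightarrow> G x" for x
    using g(1) by (auto simp: G_def F_def hl0_apply_eq_0)
  have lipG: "e-lipschitz_on ?B (\<lambda>x. F n x - G x)"
    if "e \<ge> 0" "\<And>m. m \<ge> N \<Longrightarrow> norm (X n - X m) \<le> e" for e n N
  proof (rule lipschitz_onI)
    fix x y assume xy: "x \<in> ?B" "y \<in> ?B"
    show "dist (F n x - G x) (F n y - G y) \<le> e * dist x y"
    proof (rule LIMSEQ_le_const2)
      show "(\<lambda>m. dist (F n x - F m x) (F n y - F m y)) \<longlonglongrightarrow> dist (F n x - G x) (F n y - G y)"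
        by (intro tendsto_intros G)
      have "dist (F n x - F m x) (F n y - F m y) \<le> e * dist x y" if "m \<ge> N" for m
        using lipschitz_onD[OF lip xy] \<open>\<And>m. m \<ge> N \<Longrightarrow> norm (X n - X m) \<le> e\<close>[OF that]
        by (meson mult_right_mono zero_le_dist order_trans)
      then show "\<exists>M. \<forall>m\<ge>M. dist (F n x - F m x) (F n y - F m y) \<le> e * dist x y" by blast
    qed
  qed (fact that(1))
  have GH: "G \<in> HL0_set"
    unfolding HL0_set_def
  proof (intro CollectI conjI)
    show "G cholomorphic_on ?B"
      unfolding cholomorphic_on_def
    proof
      fix x assume x: "x \<in> ?B"
      have "(G has_derivative D' x) (at x within ?B)"
        by (rule has_derivative_transform[OF x _ g(2)[OF x]]) (simp add: G_def)
      moreover have "clinear (D' x)"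
        unfolding clinear_iff
      proof (intro conjI allI)
        fix h k :: 'a and c :: complex
        have lin: "D n x (h + k) = D n x h + D n x k" "D n x (c *\<^sub>C h) = c *\<^sub>C D n x h" for n
          using D(1)[OF x, of n] by (simp_all add: clinear_iff)
        have "(\<lambda>n. D n x (h + k)) \<longlonglongrightarrow> D' x h + D' x k"
          unfolding lin by (intro tendsto_intros D' x)
        then show "D' x (h + k) = D' x h + D' x k"
          using D'[OF x] LIMSEQ_unique by blast
        have "(\<lambda>n. D n x (c *\<^sub>C h)) \<longlonglongrightarrow> c *\<^sub>C D' x h"
          unfolding lin by (intro bounded_linear.tendsto[OF bounded_linear_scaleC_right] D' x)
        then show "D' x (c *\<^sub>C h) = c *\<^sub>C D' x h"
          using D'[OF x] LIMSEQ_unique by blast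
      qed
      ultimately show "\<exists>D. clinear D \<and> (G has_derivative D) (at x within ?B)"
        by blast
    qed
    obtain N where "\<And>m n. m \<ge> N \<Longrightarrow> n \<ge> N \<Longrightarrow> norm (X m - X n) \<le> 1"
      using Xe[of 1] by auto
    then have "1-lipschitz_on ?B (\<lambda>x. F N x - G x)"
      by (intro lipG[where N = N]) auto
    from lipschitz_on_diff[OF lipschitz_on_hl0_apply[of "X N"] this]
    show "\<exists>C. C-lipschitz_on ?B G"
      unfolding F_def by auto
    show "G 0 = 0"
      using G[of 0] by (simp add: F_def hl0_apply_0 LIMSEQ_const_iff)
  qed (simp add: G_def)
  have "X \<longlonglongrightarrow> Abs_hl0 G"
    unfolding LIMSEQ_def dist_norm
  proof (intro allI impI)
    fix e :: real assume e: "e > 0"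
    obtain N where N: "\<And>m n. m \<ge> N \<Longrightarrow> n \<ge> N \<Longrightarrow> norm (X m - X n) \<le> e / 2"
      using Xe[of "e / 2"] e by auto
    have "norm (X n - Abs_hl0 G) < e" if "n \<ge> N" for n
    proof -
      have "(e / 2)-lipschitz_on ?B (\<lambda>x. F n x - G x)"
        using e N that by (intro lipG[where N = N]) auto
      then have "norm (X n - Abs_hl0 G) \<le> e / 2"
        unfolding norm_hl0.rep_eq minus_hl0.rep_eq Abs_hl0_inverse[OF GH] F_def
        by (rule lipschitz_const_le)
      then show ?thesis using e by simp
    qed
    then show "\<exists>N. \<forall>n\<ge>N. norm (X n - Abs_hl0 G) < e" by blast
  qed
  then show "convergent X"
    unfolding convergent_def by blast
qed


section \<open>Composition operators\<close>

text \<open>Extension by \<open>0\<close> is preserved by composition, as elements of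
  \<^typ>\<open>('a, complex) hl0\<close> vanish at \<open>0\<close>. The right-hand side is only meaningful if the symbol
  maps the unit ball into the unit ball.\<close>

definition composition_operator ::
    "('b::complex_normed_vector, 'a::complex_normed_vector) hl0 \<Rightarrow>
      ('a, complex) hl0 \<Rightarrow> ('b, complex) hl0"
  where "composition_operator \<phi> f = Abs_hl0 (hl0_apply f \<circ> hl0_apply \<phi>)"

lemma hl0_apply_composition_operator:
  assumes "hl0_apply \<phi> ` ball 0 1 \<subseteq> ball 0 1"
  shows "hl0_apply (composition_operator \<phi> f) = hl0_apply f \<circ> hl0_apply \<phi>"
proof -
  have "hl0_apply f \<circ> hl0_apply \<phi> \<in> HL0_set"
    unfolding HL0_set_def
  proof (intro CollectI conjI)
    show "hl0_apply f \<circ> hl0_apply \<phi> cholomorphic_on ball 0 1"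
      unfolding cholomorphic_on_def
    proof
      fix x :: 'b assume x: "x \<in> ball 0 1"
      then have \<phi>x: "hl0_apply \<phi> x \<in> ball 0 1"
        using assms by blast
      obtain D where D: "clinear D" "(hl0_apply \<phi> has_derivative D) (at x)"
        by (rule hl0_apply_has_derivative[OF x])
      obtain E where E: "clinear E" "(hl0_apply f has_derivative E) (at (hl0_apply \<phi> x))"
        by (rule hl0_apply_has_derivative[OF \<phi>x])
      have "clinear (E \<circ> D)"
        using D(1) E(1) by (simp add: clinear_iff)
      moreover have "(hl0_apply f \<circ> hl0_apply \<phi> has_derivative E \<circ> D) (at x within ball 0 1)"
        by (rule has_derivative_at_withinI[OF diff_chain_at[OF D(2) E(2)]])
      ultimately show "\<exists>D. clinear D \<and>
          (hl0_apply f \<circ> hl0_apply \<phi> has_derivative D) (at x within ball 0 1)"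
        by blast
    qed
    have "(norm f * norm \<phi>)-lipschitz_on (ball 0 1) (hl0_apply f \<circ> hl0_apply \<phi>)"
      by (intro lipschitz_on_compose lipschitz_on_hl0_apply
          lipschitz_on_subset[OF lipschitz_on_hl0_apply assms])
    then show "\<exists>C. C-lipschitz_on (ball 0 1) (hl0_apply f \<circ> hl0_apply \<phi>)" ..
  qed (simp_all add: hl0_apply_0 hl0_apply_eq_0)
  then show ?thesis
    unfolding composition_operator_def by (rule Abs_hl0_inverse)
qed

end

theory Submission
  imports Defs "HOL-Complex_Analysis.Conformal_Mappings"
begin

text \<open>
  The implications from a linear isometry \<open>T\<close> to an isometric composition operator, and from there
  to an isomorphism, are formal. The work lies in the way back.

  Suppose that \<open>C = C\<^sub>\<phi>\<close> is an isomorphism with inverse \<open>S\<close>. The inverse symbol \<open>\<psi>\<close> must satisfy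
  \<open>l \<circ> \<psi> = S l\<close> for every functional \<open>l\<close> on \<open>Y\<close>, so \<open>\<psi> x\<close> is an element of the bidual of \<open>Y\<close> at
  first. Balls of holomorphic Lipschitz functions are compact for pointwise convergence
  (\<open>compact_hl0_cball\<close>) and \<open>C\<close> is injective, hence the functional \<open>l \<mapsto> S l x\<close> is continuous for
  pointwise convergence on bounded sets, and finite-rank approximation of the identity shows that
  it is evaluation at a point of \<open>Y\<close> (\<open>evaluation_point_exists\<close>). The resulting \<open>\<psi>\<close> is holomorphic
  because it is weakly holomorphic (\<open>weakly_hl0_imp_hl0\<close>), it maps into the unit ball because \<open>S\<close> is
  multiplicative, and it is a left inverse of \<open>\<phi>\<close> by construction and a right inverse because \<open>C\<close>
  is injective (\<open>onto_isomorphism_imp_inverse_symbol\<close>).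

  A biholomorphic map of the open unit balls that fixes \<open>0\<close> is linear and isometric by Cartan's
  uniqueness theorem (\<open>Cartan_uniqueness\<close>, \<open>biholomorphic_imp_linear_isometry\<close>).

  The complex analysis involved reduces to one tool: a Schwarz lemma for zeros of order \<open>n\<close>
  (\<open>Schwarz_order\<close>), applied along complex lines and tested on norming functionals. It bounds the
  first order Taylor remainder of a holomorphic map by its Lipschitz constant
  (\<open>lipschitz_second_order\<close>), which gives both the compactness and the passage from weak to
  strong holomorphy, and it carries the induction in Cartan's theorem.
\<close>

section \<open>Norming functionals\<close>

text \<open>Minimal sublinear functionals take the place of one-dimensional extension steps in the proof
  of the Hahn-Banach theorem.\<close>

definition sublinear :: "('a::real_vector \<Rightarrow> real) \<Rightarrow> bool"
  where "sublinear p \<longleftrightarrow>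
    (\<forall>x y. p (x + y) \<le> p x + p y) \<and> (\<forall>t\<ge>0. \<forall>x. p (t *\<^sub>R x) = t * p x)"

lemma sublinear_add: "sublinear p \<Longrightarrow> p (x + y) \<le> p x + p y"
  and sublinear_scaleR: "sublinear p \<Longrightarrow> 0 \<le> t \<Longrightarrow> p (t *\<^sub>R x) = t * p x"
  by (simp_all add: sublinear_def)

lemma sublinear_zero: "sublinear p \<Longrightarrow> p 0 = 0"
  using sublinear_scaleR[of p 0 0] by simp

lemma sublinear_lower: "sublinear p \<Longrightarrow> - p (- x) \<le> p x"
  using sublinear_add[of p x "- x"] by (simp add: sublinear_zero)

lemma sublinearI:
  assumes add: "\<And>x y. p (x + y) \<le> p x + p y"
    and scale: "\<And>t x. 0 < t \<Longrightarrow> p (t *\<^sub>R x) \<le> t * p x"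
    and zero: "p 0 = 0"
  shows "sublinear p"
  unfolding sublinear_def
proof (intro conjI allI impI add)
  fix t :: real and x assume "0 \<le> t"
  show "p (t *\<^sub>R x) = t * p x"
  proof (cases "t = 0")
    case False
    then have t: "0 < t" using \<open>0 \<le> t\<close> by simp
    have "p (inverse t *\<^sub>R t *\<^sub>R x) \<le> inverse t * p (t *\<^sub>R x)"
      using t by (intro scale) simp
    then have "t * p x \<le> p (t *\<^sub>R x)"
      using t by (simp add: field_simps)
    then show ?thesis
      using scale[OF t, of x] by simp
  qed (simp add: zero)
qed

text \<open>Any sublinear functional can be lowered along a ray so that it becomes additive in one
  chosen direction. A minimal sublinear functional admits no such lowering, hence is linear.\<close>

lemma sublinear_lowering:
  assumes p: "sublinear p"
  obtains q where "sublinear q" "\<And>x. q x \<le> p x" "\<And>x. q x \<le> p (x + a) - p a"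
proof -
  define q where "q x = (INF t\<in>{0..}. p (x + t *\<^sub>R a) - t * p a)" for x
  have bdd: "bdd_below ((\<lambda>t. p (x + t *\<^sub>R a) - t * p a) ` {0..})" for x
  proof (rule bdd_belowI2[where m = "- p (- x)"])
    fix t :: real assume "t \<in> {0..}"
    then show "- p (- x) \<le> p (x + t *\<^sub>R a) - t * p a"
      using sublinear_add[OF p, of "- x" "x + t *\<^sub>R a"] sublinear_scaleR[OF p, of t a] by simp
  qed
  have le: "q x \<le> p (x + t *\<^sub>R a) - t * p a" if "0 \<le> t" for x t
    unfolding q_def using that by (intro cINF_lower bdd) simp
  have ge: "c \<le> q x" if "\<And>t. 0 \<le> t \<Longrightarrow> c \<le> p (x + t *\<^sub>R a) - t * p a" for c x
    unfolding q_def by (rule cINF_greatest) (use that in auto)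
  have "sublinear q"
  proof (rule sublinearI)
    fix x y
    have "q (x + y) - (p (y + s *\<^sub>R a) - s * p a) \<le> q x" if s: "0 \<le> s" for s
    proof (rule ge)
      fix t :: real assume t: "0 \<le> t"
      have "p ((x + y) + (t + s) *\<^sub>R a) \<le> p (x + t *\<^sub>R a) + p (y + s *\<^sub>R a)"
        using sublinear_add[OF p, of "x + t *\<^sub>R a" "y + s *\<^sub>R a"] by (simp add: algebra_simps)
      then show "q (x + y) - (p (y + s *\<^sub>R a) - s * p a) \<le> p (x + t *\<^sub>R a) - t * p a"
        using le[of "t + s" "x + y"] s t by (simp add: algebra_simps)
    qed
    then have "q (x + y) - q x \<le> q y"
      by (intro ge) (simp add: algebra_simps)
    then show "q (x + y) \<le> q x + q y" by simp
  next
    fix t :: real and x assume t: "0 < t"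
    have "q (t *\<^sub>R x) / t \<le> q x"
    proof (rule ge)
      fix s :: real assume s: "0 \<le> s"
      have "p (t *\<^sub>R x + (t * s) *\<^sub>R a) = t * p (x + s *\<^sub>R a)"
        using sublinear_scaleR[OF p, of t "x + s *\<^sub>R a"] t by (simp add: scaleR_add_right)
      then show "q (t *\<^sub>R x) / t \<le> p (x + s *\<^sub>R a) - s * p a"
        using le[of "t * s" "t *\<^sub>R x"] s t by (simp add: field_simps)
    qed
    then show "q (t *\<^sub>R x) \<le> t * q x"
      using t by (simp add: field_simps)
  next
    show "q 0 = 0"
    proof (rule order_antisym)
      show "q 0 \<le> 0"
        using le[of 0 0] by (simp add: sublinear_zero[OF p])
      show "0 \<le> q 0"
        by (rule ge) (simp add: sublinear_scaleR[OF p])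
    qed
  qed
  moreover have "q x \<le> p x" for x
    using le[of 0 x] by simp
  moreover have "q x \<le> p (x + a) - p a" for x
    using le[of 1 x] by simp
  ultimately show thesis by (rule that)
qed

lemma minimal_sublinear_imp_linear:
  assumes p: "sublinear p" and min: "\<And>q. sublinear q \<Longrightarrow> (\<And>x. q x \<le> p x) \<Longrightarrow> q = p"
  shows "linear p"
proof -
  have add: "p (x + y) = p x + p y" for x y
  proof -
    obtain q where "sublinear q" "\<And>x. q x \<le> p x" "\<And>x. q x \<le> p (x + y) - p y"
      using sublinear_lowering[OF p, of y] by blast
    then have "p x \<le> p (x + y) - p y"
      using min by metis
    then show ?thesis
      using sublinear_add[OF p, of x y] by simp
  qed
  have neg: "p (- x) = - p x" for x
    using add[of x "- x"] sublinear_zero[OF p] by simp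
  have "p (t *\<^sub>R x) = t * p x" for t x
  proof (cases "0 \<le> t")
    case False
    then show ?thesis
      using sublinear_scaleR[OF p, of "- t" x] neg[of "t *\<^sub>R x"] by simp
  qed (rule sublinear_scaleR[OF p])
  with add show ?thesis
    by (intro linearI) simp_all
qed

lemma linear_below_sublinear:
  assumes q: "sublinear q"
  obtains u where "linear u" "\<And>x. u x \<le> q x"
proof -
  define A where "A = {p. sublinear p \<and> (\<forall>x. p x \<le> q x)}"
  define P where "P p p' \<longleftrightarrow> (\<forall>x. p' x \<le> p x)" for p p' :: "'a \<Rightarrow> real"
  have "\<exists>m\<in>A. \<forall>a\<in>A. P m a \<longrightarrow> a = m"
  proof (rule predicate_Zorn)
    show "partial_order_on A (relation_of P A)"
      by (rule partial_order_on_relation_ofI) (auto simp: P_def intro: order_trans intro!: ext order_antisym)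
  next
    fix C assume "C \<in> Chains (relation_of P A)"
    then have C: "\<And>p. p \<in> C \<Longrightarrow> p \<in> A" "\<And>p p'. p \<in> C \<Longrightarrow> p' \<in> C \<Longrightarrow> P p p' \<or> P p' p"
      unfolding Chains_def relation_of_def by auto
    show "\<exists>u\<in>A. \<forall>a\<in>C. P a u"
    proof (cases "C = {}")
      case True
      then show ?thesis using q by (auto simp: A_def)
    next
      case False
      define m where "m x = (INF p\<in>C. p x)" for x
      have sub: "sublinear p" "p x \<le> q x" if "p \<in> C" for p x
        using C(1)[OF that] by (auto simp: A_def)
      have bdd: "bdd_below ((\<lambda>p. p x) ` C)" for x
      proof (rule bdd_belowI2[where m = "- q (- x)"])
        fix p assume "p \<in> C"
        then show "- q (- x) \<le> p x"
          using sublinear_lower[OF sub(1), of p x] sub(2)[of p "- x"] by linarith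
      qed
      have le: "m x \<le> p x" if "p \<in> C" for p x
        unfolding m_def using that by (intro cINF_lower bdd)
      have ge: "c \<le> m x" if "\<And>p. p \<in> C \<Longrightarrow> c \<le> p x" for c x
        unfolding m_def by (rule cINF_greatest) (use that False in auto)
      have "sublinear m"
      proof (rule sublinearI)
        fix x y
        have "m (x + y) - p' y \<le> m x" if p': "p' \<in> C" for p'
        proof (rule ge)
          fix p assume p: "p \<in> C"
          \<comment> \<open>The smaller of the comparable \<open>p\<close>, \<open>p'\<close> bounds both summands at once.\<close>
          from C(2)[OF p p'] show "m (x + y) - p' y \<le> p x"
          proof
            assume "P p p'"
            then show ?thesis
              using le[OF p', of "x + y"] sublinear_add[OF sub(1)[OF p'], of x y]
              unfolding P_def by (smt (verit))
          next
            assume "P p' p"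
            then show ?thesis
              using le[OF p, of "x + y"] sublinear_add[OF sub(1)[OF p], of x y]
              unfolding P_def by (smt (verit))
          qed
        qed
        then have "m (x + y) - m x \<le> m y"
          by (intro ge) (simp add: algebra_simps)
        then show "m (x + y) \<le> m x + m y" by simp
      next
        fix t :: real and x assume t: "0 < t"
        have "m (t *\<^sub>R x) / t \<le> m x"
          using t le[of _ "t *\<^sub>R x"] sublinear_scaleR[OF sub(1)]
          by (intro ge) (simp add: field_simps)
        then show "m (t *\<^sub>R x) \<le> t * m x"
          using t by (simp add: field_simps)
      next
        show "m 0 = 0"
        proof (rule order_antisym)
          show "m 0 \<le> 0"
            using False le[of _ 0] sublinear_zero[OF sub(1)] by fastforce
          show "0 \<le> m 0"
            by (rule ge) (simp add: sublinear_zero[OF sub(1)])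
        qed
      qed
      moreover have "m x \<le> q x" for x
        using False le sub(2) order_trans by blast
      ultimately have "m \<in> A" by (simp add: A_def)
      then show ?thesis using le unfolding P_def by blast
    qed
  qed
  then obtain u where u: "sublinear u" "\<And>x. u x \<le> q x"
    "\<And>p. sublinear p \<Longrightarrow> (\<And>x. p x \<le> q x) \<Longrightarrow> (\<And>x. p x \<le> u x) \<Longrightarrow> p = u"
    unfolding A_def P_def by auto
  have "linear u"
    by (rule minimal_sublinear_imp_linear[OF u(1)]) (meson u order_trans)
  then show thesis using u(2) by (rule that)
qed

text \<open>Lowering the norm along the ray of \<open>a\<close> first forces any linear functional below it to have the
  value \<open>\<parallel>a\<parallel>\<close> at \<open>a\<close>.\<close>

lemma real_norming_functional:
  fixes a :: "'a::real_normed_vector"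
  obtains u :: "'a \<Rightarrow> real" where "linear u" "\<And>x. \<bar>u x\<bar> \<le> norm x" "u a = norm a"
proof -
  have "sublinear (norm :: 'a \<Rightarrow> real)"
    by (simp add: sublinear_def norm_triangle_ineq)
  from sublinear_lowering[OF this, of a] obtain q
    where q: "sublinear q" "\<And>x. q x \<le> norm x" "\<And>x. q x \<le> norm (x + a) - norm a" by blast
  obtain u where u: "linear u" "\<And>x. u x \<le> q x"
    using linear_below_sublinear[OF q(1)] by blast
  have neg: "u (- x) = - u x" for x
    using linear_neg[OF u(1)] .
  have le: "u x \<le> norm x" for x
    using u(2) q(2) order_trans by blast
  have "\<bar>u x\<bar> \<le> norm x" for x
    using le[of x] le[of "- x"] neg by (simp add: abs_le_iff)
  moreover have "u a = norm a"
    using le[of a] u(2)[of "- a"] q(3)[of "- a"] neg[of a] by simp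
  ultimately show thesis using u(1) that by blast
qed

definition dual_ball :: "('a::complex_normed_vector \<Rightarrow> complex) set"
  where "dual_ball = {f. clinear f \<and> (\<forall>x. cmod (f x) \<le> norm x)}"

lemma dual_ball_add: "f \<in> dual_ball \<Longrightarrow> f (x + y) = f x + f y"
  and dual_ball_scaleC: "f \<in> dual_ball \<Longrightarrow> f (c *\<^sub>C x) = c * f x"
  and dual_ball_norm: "f \<in> dual_ball \<Longrightarrow> cmod (f x) \<le> norm x"
  by (simp_all add: dual_ball_def clinear_iff scaleC_complex_def)

lemma clinear_scaleR:
  "clinear f \<Longrightarrow> f (r *\<^sub>R x) = r *\<^sub>R f x"
  by (simp add: clinear_iff flip: scaleC_complex_of_real)

lemma clinear_imp_linear: "clinear f \<Longrightarrow> linear f"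
  by (intro linearI) (simp_all add: clinear_scaleR, simp add: clinear_iff)

lemma clinear_imp_bounded_linear:
  assumes "clinear f" "\<And>x. norm (f x) \<le> K * norm x"
  shows "bounded_linear f"
  using assms by (intro bounded_linear_intro[where K = K])
    (simp_all add: clinear_scaleR mult.commute, simp add: clinear_iff)

lemma dual_ball_bounded_linear: "f \<in> dual_ball \<Longrightarrow> bounded_linear f"
  unfolding dual_ball_def by (auto intro: clinear_imp_bounded_linear[where K = 1])

lemma dual_ball_diff: "f \<in> dual_ball \<Longrightarrow> f (x - y) = f x - f y"
  by (rule linear_diff[OF bounded_linear.linear[OF dual_ball_bounded_linear]])

text \<open>The Hahn-Banach theorem in the form used throughout: a real norming functional \<open>u\<close> is
  complexified to \<open>x \<mapsto> u x - i u (i x)\<close>, and rotating the value to the positive real axis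
  shows that the norm does not grow.\<close>

lemma norming_functional:
  fixes a :: "'a::complex_normed_vector"
  obtains f where "f \<in> dual_ball" "f a = complex_of_real (norm a)"
proof -
  obtain u :: "'a \<Rightarrow> real"
    where u: "linear u" "\<And>x. \<bar>u x\<bar> \<le> norm x" "u a = norm a"
    using real_norming_functional[of a] by blast
  define f where "f x = Complex (u x) (- u (\<i> *\<^sub>C x))" for x
  have ua: "u (x + y) = u x + u y" for x y
    by (rule linear_add[OF u(1)])
  have us: "u (r *\<^sub>R x) = r * u x" for r x
    using linear_scale[OF u(1), of r x] by simp
  have uii: "u (\<i> *\<^sub>C \<i> *\<^sub>C x) = - u x" for x
  proof -
    have "\<i> *\<^sub>C \<i> *\<^sub>C x = (- 1) *\<^sub>R x"
      using scaleC_complex_of_real[of "-1" x] by (simp add: scaleC_scaleC)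
    then show ?thesis using us[of "-1" x] by simp
  qed
  have cs: "c *\<^sub>C x = Re c *\<^sub>R x + Im c *\<^sub>R (\<i> *\<^sub>C x)" for c and x :: 'a
  proof -
    have "c *\<^sub>C x = (complex_of_real (Re c) + complex_of_real (Im c) * \<i>) *\<^sub>C x"
      by (simp add: complex_eq mult.commute)
    then show ?thesis
      by (simp add: scaleC_add_left scaleC_complex_of_real flip: scaleC_scaleC)
  qed
  have "f (x + y) = f x + f y" for x y
    by (simp add: f_def scaleC_add_right ua complex_eq_iff)
  moreover have f: "f (c *\<^sub>C x) = c * f x" for c x
  proof -
    have uc: "u (c *\<^sub>C x) = Re c * u x + Im c * u (\<i> *\<^sub>C x)" for x
      by (subst cs) (simp add: ua us)
    have "\<i> *\<^sub>C c *\<^sub>C x = c *\<^sub>C \<i> *\<^sub>C x"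
      by (simp add: scaleC_scaleC mult.commute)
    then have "u (\<i> *\<^sub>C c *\<^sub>C x) = Re c * u (\<i> *\<^sub>C x) - Im c * u x"
      by (simp only: uc uii)
    then show ?thesis
      unfolding f_def uc by (simp add: complex_eq_iff)
  qed
  moreover have bound: "cmod (f x) \<le> norm x" for x
  proof -
    define c where "c = (if f x = 0 then 1 else cnj (f x) / cmod (f x))"
    have c: "cmod c = 1" by (simp add: c_def norm_divide)
    have "c * f x = complex_of_real (cmod (f x))"
      by (simp add: c_def complex_norm_square power2_eq_square field_simps)
         (simp add: complex_norm_square[symmetric] power2_eq_square mult.commute)
    then have "cmod (f x) = Re (f (c *\<^sub>C x))"
      by (simp add: f)
    also have "\<dots> \<le> norm (c *\<^sub>C x)"
      using u(2)[of "c *\<^sub>C x"] by (simp add: f_def)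
    finally show ?thesis by (simp add: norm_scaleC c)
  qed
  ultimately have "f \<in> dual_ball"
    by (simp add: dual_ball_def clinear_iff scaleC_complex_def)
  moreover have "f a = complex_of_real (norm a)"
  proof -
    have re: "Re (f a) = norm a" by (simp add: f_def u)
    have "(cmod (f a))\<^sup>2 \<le> (norm a)\<^sup>2"
      using bound[of a] by (intro power_mono) auto
    then have "Im (f a) = 0"
      by (simp add: cmod_power2 re)
    then show ?thesis using re by (simp add: complex_eq_iff)
  qed
  ultimately show thesis by (rule that)
qed

lemma norm_le_dual_ball:
  assumes "\<And>f. f \<in> dual_ball \<Longrightarrow> cmod (f x) \<le> M"
  shows "norm x \<le> M"
  using norming_functional[of x] assms by (metis norm_of_real abs_norm_cancel)

lemma eq_dual_ball:
  assumes "\<And>f. f \<in> dual_ball \<Longrightarrow> f x = f y"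
  shows "x = y"
  using norm_le_dual_ball[of "x - y" 0] assms by (auto simp: dual_ball_diff)

section \<open>Holomorphic maps along complex lines\<close>

lemma cholomorphic_on_compose:
  assumes f: "f cholomorphic_on S" and g: "g cholomorphic_on T" and sub: "f ` S \<subseteq> T"
  shows "(\<lambda>x. g (f x)) cholomorphic_on S"
  unfolding cholomorphic_on_def
proof
  fix x assume x: "x \<in> S"
  obtain D where D: "clinear D" "(f has_derivative D) (at x within S)"
    using f x unfolding cholomorphic_on_def by blast
  obtain E where E: "clinear E" "(g has_derivative E) (at (f x) within T)"
    using g x sub unfolding cholomorphic_on_def by blast
  have "((\<lambda>x. g (f x)) has_derivative (\<lambda>h. E (D h))) (at x within S)"
    using diff_chain_within[OF D(2) has_derivative_subset[OF E(2) sub]] by (simp add: o_def)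
  moreover have "clinear (\<lambda>h. E (D h))"
    using D(1) E(1) by (simp add: clinear_iff)
  ultimately show "\<exists>D. clinear D \<and> ((\<lambda>x. g (f x)) has_derivative D) (at x within S)"
    by blast
qed

lemma cholomorphic_on_linear: "clinear T \<Longrightarrow> bounded_linear T \<Longrightarrow> T cholomorphic_on S"
  unfolding cholomorphic_on_def using bounded_linear_imp_has_derivative by blast

lemma cholomorphic_on_const: "(\<lambda>_. c) cholomorphic_on S"
  unfolding cholomorphic_on_def by (auto intro!: exI[of _ "\<lambda>_. 0"] simp: clinear_iff)

lemma cholomorphic_on_diff:
  assumes "f cholomorphic_on S" "g cholomorphic_on S"
  shows "(\<lambda>x. f x - g x) cholomorphic_on S"
  using cholomorphic_on_add[OF assms(1) cholomorphic_on_scaleC[OF assms(2), of "- 1"]] by simp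

lemma cholomorphic_on_line: "(\<lambda>\<zeta>. x + \<zeta> *\<^sub>C h) cholomorphic_on S"
proof (intro cholomorphic_on_add cholomorphic_on_const cholomorphic_on_linear)
  show "clinear (\<lambda>\<zeta>. \<zeta> *\<^sub>C h)"
    by (simp add: clinear_iff scaleC_add_left scaleC_scaleC scaleC_complex_def)
  then show "bounded_linear (\<lambda>\<zeta>. \<zeta> *\<^sub>C h)"
    by (rule clinear_imp_bounded_linear[where K = "norm h"]) (simp add: norm_scaleC mult.commute)
qed

lemma cholomorphic_on_imp_holomorphic_on:
  fixes f :: "complex \<Rightarrow> complex"
  assumes "f cholomorphic_on S"
  shows "f holomorphic_on S"
  unfolding holomorphic_on_def field_differentiable_def
proof
  fix x assume "x \<in> S"
  then obtain D where D: "clinear D" "(f has_derivative D) (at x within S)"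
    using assms unfolding cholomorphic_on_def by blast
  have "D h = D 1 * h" for h
  proof -
    have "D (h *\<^sub>C 1) = h *\<^sub>C D 1" using D(1) unfolding clinear_iff by blast
    then show ?thesis by (simp add: scaleC_complex_def mult.commute)
  qed
  then have "D = (*) (D 1)" by blast
  with D(2) show "\<exists>f'. (f has_field_derivative f') (at x within S)"
    unfolding has_field_derivative_def by metis
qed

lemma cholomorphic_on_dual_ball:
  assumes "f cholomorphic_on S" "l \<in> dual_ball"
  shows "(\<lambda>x. l (f x)) cholomorphic_on S"
  using assms dual_ball_bounded_linear[OF assms(2)]
  by (intro cholomorphic_on_compose[OF assms(1), where T = UNIV] cholomorphic_on_linear)
     (auto simp: dual_ball_def)

section \<open>The Schwarz lemma of higher order\<close>

lemma holomorphic_small_at_0: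
  assumes "q holomorphic_on ball 0 1"
    and small: "\<And>e. 0 < e \<Longrightarrow> \<forall>\<^sub>F z in at 0. cmod (q z) \<le> e"
  shows "q 0 = 0"
proof -
  have "(q \<longlongrightarrow> 0) (at 0)"
    unfolding tendsto_iff dist_norm
  proof (intro allI impI)
    fix e :: real assume "0 < e"
    then show "\<forall>\<^sub>F z in at 0. cmod (q z - 0) < e"
      using small[of "e / 2"] by (auto elim: eventually_mono)
  qed
  moreover have "isCont q 0"
    using holomorphic_on_imp_continuous_on[OF assms(1)] by (simp add: continuous_on_eq_continuous_at)
  ultimately show ?thesis
    unfolding isCont_def by (metis LIM_unique)
qed

lemma Schwarz_bound:
  assumes hol: "q holomorphic_on ball 0 1" and q0: "q 0 = 0"
    and bound: "\<And>z. z \<in> ball 0 1 \<Longrightarrow> cmod (q z) \<le> M" and z: "z \<in> ball 0 1"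
  shows "cmod (q z) \<le> M * cmod z"
proof (rule field_le_epsilon)
  fix e :: real assume e: "0 < e"
  have "0 \<le> M"
    using bound[of 0] by (simp add: q0)
  then have pos: "0 < M + e" using e by simp
  have "cmod (q z / of_real (M + e)) \<le> cmod z"
  proof (rule Schwarz_Lemma(1))
    show "(\<lambda>z. q z / of_real (M + e)) holomorphic_on ball 0 1"
      using pos hol by (intro holomorphic_intros) (simp_all del: of_real_add)
    fix w :: complex assume "cmod w < 1"
    then have "cmod (q w) < M + e" using bound[of w] e by simp
    then show "cmod (q w / of_real (M + e)) < 1"
      using pos by (simp add: norm_divide del: of_real_add)
  qed (use z q0 in simp_all)
  then have "cmod (q z) \<le> (M + e) * cmod z"
    using pos by (simp add: norm_divide field_simps del: of_real_add)
  also have "\<dots> \<le> M * cmod z + e"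
    using z e by (simp add: distrib_right mult_left_le)
  finally show "cmod (q z) \<le> M * cmod z + e" .
qed

text \<open>Dividing by the variable lowers the order of vanishing by one and, by the ordinary Schwarz
  lemma, keeps the bound.\<close>

lemma Schwarz_order_disc:
  fixes q :: "complex \<Rightarrow> complex"
  assumes "q holomorphic_on ball 0 1" "\<And>z. z \<in> ball 0 1 \<Longrightarrow> cmod (q z) \<le> M"
    and "\<And>e. 0 < e \<Longrightarrow> \<forall>\<^sub>F z in at 0. cmod (q z) \<le> e * cmod z ^ n"
    and "z \<in> ball 0 1"
  shows "cmod (q z) \<le> M * cmod z ^ Suc n"
  using assms
proof (induction n arbitrary: q z)
  case (0 q z)
  then show ?case
    using Schwarz_bound[of q M z] holomorphic_small_at_0[of q] by simp
next
  case (Suc n q z)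
  have in_disc: "\<forall>\<^sub>F z :: complex in at 0. cmod z < 1 \<and> z \<noteq> 0"
    by (auto simp: eventually_at intro: exI[of _ 1])
  have "q 0 = 0"
  proof (rule holomorphic_small_at_0[OF Suc.prems(1)])
    fix e :: real assume e: "0 < e"
    from Suc.prems(3)[OF e] in_disc show "\<forall>\<^sub>F z in at 0. cmod (q z) \<le> e"
    proof eventually_elim
      case (elim z)
      then have "cmod z ^ Suc n \<le> 1" by (intro power_le_one) auto
      then have "e * cmod z ^ Suc n \<le> e * 1" using e by (intro mult_left_mono) auto
      then show ?case using elim(1) by linarith
    qed
  qed
  then obtain h where h: "h holomorphic_on ball 0 1" "\<And>z. norm z < 1 \<Longrightarrow> q z = z * h z"
    by (metis Schwarz3[OF Suc.prems(1)])
  have small_h: "\<forall>\<^sub>F z in at 0. cmod (h z) \<le> e * cmod z ^ n" if e: "0 < e" for e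
    using Suc.prems(3)[OF e] in_disc
  proof eventually_elim
    case (elim z)
    then have "cmod z * cmod (h z) \<le> cmod z * (e * cmod z ^ n)"
      using h(2)[of z] by (simp add: norm_mult mult_ac)
    then show ?case using elim by simp
  qed
  have "h 0 = 0"
  proof (rule holomorphic_small_at_0[OF h(1)])
    fix e :: real assume e: "0 < e"
    from small_h[OF e] in_disc show "\<forall>\<^sub>F z in at 0. cmod (h z) \<le> e"
    proof eventually_elim
      case (elim z)
      then have "cmod z ^ n \<le> 1" by (intro power_le_one) auto
      then have "e * cmod z ^ n \<le> e * 1" using e by (intro mult_left_mono) auto
      then show ?case using elim(1) by linarith
    qed
  qed
  have bound_h: "cmod (h z) \<le> M" if z: "z \<in> ball 0 1" for z
  proof (cases "z = 0")
    case True
    then show ?thesis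
      using Suc.prems(2)[of 0] \<open>h 0 = 0\<close> \<open>q 0 = 0\<close> by simp
  next
    case False
    have "cmod (q z) \<le> M * cmod z"
      by (rule Schwarz_bound[OF Suc.prems(1) \<open>q 0 = 0\<close> Suc.prems(2) z])
    then show ?thesis
      using False z h(2)[of z] by (simp add: norm_mult mult.commute)
  qed
  have "cmod (h z) \<le> M * cmod z ^ Suc n"
    by (rule Suc.IH[OF h(1) bound_h small_h Suc.prems(4)])
  then have "cmod z * cmod (h z) \<le> cmod z * (M * cmod z ^ Suc n)"
    by (rule mult_left_mono) simp
  then show ?case
    using h(2)[of z] Suc.prems(4) by (simp add: norm_mult mult_ac)
qed

text \<open>For values in a normed space the bound is tested on norming functionals.\<close>

lemma Schwarz_order:
  fixes Q :: "complex \<Rightarrow> 'b::complex_normed_vector"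
  assumes hol: "Q cholomorphic_on ball 0 R" and bound: "\<And>z. z \<in> ball 0 R \<Longrightarrow> norm (Q z) \<le> M"
    and small: "\<And>e. 0 < e \<Longrightarrow> \<forall>\<^sub>F z in at 0. norm (Q z) \<le> e * cmod z ^ n"
    and z: "z \<in> ball 0 R"
  shows "norm (Q z) \<le> M * (cmod z / R) ^ Suc n"
proof (rule norm_le_dual_ball)
  fix l :: "'b \<Rightarrow> complex" assume l: "l \<in> dual_ball"
  have R: "0 < R" using z by (auto intro: le_less_trans[OF norm_ge_zero])
  define q where "q \<zeta> = l (Q (of_real R * \<zeta>))" for \<zeta>
  have map: "of_real R * \<zeta> \<in> ball 0 R" if "\<zeta> \<in> ball 0 1" for \<zeta> :: complex
    using that R by (simp add: norm_mult)
  have "(\<lambda>\<zeta>. complex_of_real R * \<zeta>) cholomorphic_on ball 0 1"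
    using cholomorphic_on_line[of 0 "complex_of_real R" "ball 0 1"]
    unfolding scaleC_complex_def by (simp add: mult.commute)
  then have "q cholomorphic_on ball 0 1"
    unfolding q_def by (rule cholomorphic_on_compose[OF _ cholomorphic_on_dual_ball[OF hol l]])
      (use map in blast)
  then have "cmod (q (z / of_real R)) \<le> M * cmod (z / of_real R) ^ Suc n"
  proof (rule Schwarz_order_disc[OF cholomorphic_on_imp_holomorphic_on])
    show "cmod (q \<zeta>) \<le> M" if "\<zeta> \<in> ball 0 1" for \<zeta>
      using bound[OF map[OF that]] dual_ball_norm[OF l] order_trans unfolding q_def by blast
    fix e :: real assume e: "0 < e"
    then have "0 < e / R ^ n" using R by simp
    from small[OF this] obtain d where d: "0 < d"
      "\<And>z. z \<noteq> 0 \<Longrightarrow> cmod z < d \<Longrightarrow> norm (Q z) \<le> e / R ^ n * cmod z ^ n"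
      unfolding eventually_at by auto
    have "cmod (q \<zeta>) \<le> e * cmod \<zeta> ^ n" if "\<zeta> \<noteq> 0" "cmod \<zeta> < d / R" for \<zeta>
    proof -
      have "norm (Q (of_real R * \<zeta>)) \<le> e / R ^ n * cmod (of_real R * \<zeta>) ^ n"
        using that R by (intro d) (auto simp: norm_mult field_simps)
      also have "\<dots> = e * cmod \<zeta> ^ n"
        using R by (simp add: norm_mult power_mult_distrib)
      finally show ?thesis
        using dual_ball_norm[OF l] order_trans unfolding q_def by blast
    qed
    then show "\<forall>\<^sub>F \<zeta> in at 0. cmod (q \<zeta>) \<le> e * cmod \<zeta> ^ n"
      unfolding eventually_at using d(1) R by (intro exI[of _ "d / R"]) auto
  qed (use z R in \<open>simp add: norm_divide\<close>)
  then show "cmod (l (Q z)) \<le> M * (cmod z / R) ^ Suc n"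
    using R by (simp add: q_def norm_divide)
qed

lemma has_derivative_remainder_line:
  fixes f :: "'a::complex_normed_vector \<Rightarrow> 'b::complex_normed_vector"
  assumes "(f has_derivative D) (at x)" and e: "0 < e"
  shows "\<forall>\<^sub>F \<zeta> in at 0. norm (f (x + \<zeta> *\<^sub>C h) - f x - D (\<zeta> *\<^sub>C h)) \<le> e * cmod \<zeta>"
proof -
  define e' where "e' = e / (norm h + 1)"
  have pos: "0 < norm h + 1" by (simp add: add_nonneg_pos)
  then have e': "0 < e'" using e by (simp add: e'_def)
  then obtain d where d: "0 < d"
    "\<And>y. norm (y - x) < d \<Longrightarrow> norm (f y - f x - D (y - x)) \<le> e' * norm (y - x)"
    using assms(1) unfolding has_derivative_at_alt by blast
  have "norm (f (x + \<zeta> *\<^sub>C h) - f x - D (\<zeta> *\<^sub>C h)) \<le> e * cmod \<zeta>"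
    if "cmod \<zeta> < d / (norm h + 1)" for \<zeta>
  proof -
    have "norm (\<zeta> *\<^sub>C h) \<le> cmod \<zeta> * (norm h + 1)"
      by (simp add: norm_scaleC mult_left_mono)
    also have "\<dots> < d" using that pos by (simp add: field_simps)
    finally have "norm (f (x + \<zeta> *\<^sub>C h) - f x - D (\<zeta> *\<^sub>C h)) \<le> e' * norm (\<zeta> *\<^sub>C h)"
      using d(2)[of "x + \<zeta> *\<^sub>C h"] by simp
    also have "\<dots> \<le> e' * (cmod \<zeta> * (norm h + 1))"
      using e' by (intro mult_left_mono) (simp_all add: norm_scaleC mult_left_mono)
    also have "\<dots> = e * cmod \<zeta>" using pos by (simp add: e'_def)
    finally show ?thesis .
  qed
  then show ?thesis
    unfolding eventually_at using d(1) pos by (intro exI[of _ "d / (norm h + 1)"]) auto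
qed

text \<open>The remainder \<open>f (x + \<zeta> h) - f x - \<zeta> D h\<close> is \<open>o(\<zeta>)\<close> and bounded on a disc of radius
  \<open>(1 - \<parallel>x\<parallel>) / \<parallel>h\<parallel>\<close>, so the Schwarz lemma of order two applies at \<open>\<zeta> = 1\<close>. The constant depends
  on \<open>f\<close> only through its Lipschitz constant; this uniformity is what makes complex
  differentiability stable under pointwise limits and weak limits.\<close>

lemma lipschitz_second_order:
  fixes f :: "'a::complex_normed_vector \<Rightarrow> 'b::complex_normed_vector"
  assumes hol: "f cholomorphic_on ball 0 1" and lip: "K-lipschitz_on (ball 0 1) f"
    and D: "clinear D" "(f has_derivative D) (at x)" and x: "x \<in> ball 0 1"
    and h: "norm h < 1 - norm x"
  shows "norm (f (x + h) - f x - D h) \<le> 2 * K * (norm h)\<^sup>2 / (1 - norm x)"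
proof (cases "h = 0")
  case True
  then show ?thesis
    using linear_0[OF clinear_imp_linear[OF D(1)]] by simp
next
  case False
  define R where "R = (1 - norm x) / norm h"
  have R: "1 < R" "R * norm h = 1 - norm x" using h False by (simp_all add: R_def)
  have K: "0 \<le> K" using lipschitz_on_nonneg[OF lip] .
  have DK: "norm (D h) \<le> K * norm h"
    by (rule has_derivative_lipschitz_bound[OF lip open_ball x D(2)])
  have Ds: "D (\<zeta> *\<^sub>C h) = \<zeta> *\<^sub>C D h" for \<zeta>
    using D(1) by (simp add: clinear_iff)
  define Q where "Q \<zeta> = (f (x + \<zeta> *\<^sub>C h) - f x) - (0 + \<zeta> *\<^sub>C D h)" for \<zeta>
  have line: "x + \<zeta> *\<^sub>C h \<in> ball 0 1" "cmod \<zeta> * norm h \<le> 1 - norm x" if "\<zeta> \<in> ball 0 R" for \<zeta>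
  proof -
    have "cmod \<zeta> * norm h < 1 - norm x"
      using that False R(2) mult_strict_right_mono[of "cmod \<zeta>" R "norm h"] by simp
    then show "x + \<zeta> *\<^sub>C h \<in> ball 0 1" "cmod \<zeta> * norm h \<le> 1 - norm x"
      using norm_triangle_ineq[of x "\<zeta> *\<^sub>C h"] by (simp_all add: norm_scaleC)
  qed
  have "norm (Q 1) \<le> 2 * K * (1 - norm x) * (cmod 1 / R) ^ Suc 1"
  proof (rule Schwarz_order)
    show "Q cholomorphic_on ball 0 R"
      unfolding Q_def
      by (intro cholomorphic_on_diff cholomorphic_on_const cholomorphic_on_line
          cholomorphic_on_compose[OF cholomorphic_on_line hol]) (use line in blast)
    show "norm (Q \<zeta>) \<le> 2 * K * (1 - norm x)" if "\<zeta> \<in> ball 0 R" for \<zeta>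
    proof -
      have "norm (f (x + \<zeta> *\<^sub>C h) - f x) \<le> K * (cmod \<zeta> * norm h)"
        using lipschitz_onD[OF lip line(1)[OF that] x] by (simp add: dist_norm norm_scaleC)
      moreover have "norm (\<zeta> *\<^sub>C D h) \<le> K * (cmod \<zeta> * norm h)"
        using mult_left_mono[OF DK, of "cmod \<zeta>"] by (simp add: norm_scaleC mult_ac)
      ultimately have "norm (Q \<zeta>) \<le> 2 * (K * (cmod \<zeta> * norm h))"
        unfolding Q_def using norm_triangle_ineq4[of "f (x + \<zeta> *\<^sub>C h) - f x" "0 + \<zeta> *\<^sub>C D h"] by simp
      also have "\<dots> \<le> 2 * (K * (1 - norm x))"
        using line(2)[OF that] K by (intro mult_left_mono) auto
      finally show ?thesis by simp
    qed
    show "\<forall>\<^sub>F \<zeta> in at 0. norm (Q \<zeta>) \<le> e * cmod \<zeta> ^ 1" if "0 < e" for e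
      using has_derivative_remainder_line[OF D(2) that, of h] by (simp add: Q_def Ds)
  qed (use R in simp)
  also have "\<dots> = 2 * K * (norm h)\<^sup>2 / (1 - norm x)"
    using False h by (simp add: R_def power2_eq_square)
  finally show ?thesis by (simp add: Q_def)
qed

lemma has_derivative_quadratic:
  assumes D: "bounded_linear D" and r: "0 < r"
    and quad: "\<And>h. norm h < r \<Longrightarrow> norm (f (x + h) - f x - D h) \<le> C * (norm h)\<^sup>2"
  shows "(f has_derivative D) (at x)"
  unfolding has_derivative_at_alt
proof (intro conjI allI impI D)
  fix e :: real assume e: "0 < e"
  define d where "d = min r (e / (\<bar>C\<bar> + 1))"
  have pos: "0 < \<bar>C\<bar> + 1" by simp
  have "0 < d" using e r by (simp add: d_def)
  moreover have "norm (f y - f x - D (y - x)) \<le> e * norm (y - x)" if "norm (y - x) < d" for y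
  proof -
    have "norm (f y - f x - D (y - x)) \<le> C * (norm (y - x))\<^sup>2"
      using quad[of "y - x"] that by (simp add: d_def)
    also have "\<dots> \<le> (\<bar>C\<bar> + 1) * norm (y - x) * norm (y - x)"
      by (simp add: power2_eq_square mult_right_mono mult.assoc)
    also have "\<dots> \<le> e * norm (y - x)"
      using that pos by (intro mult_right_mono) (simp_all add: d_def field_simps)
    finally show ?thesis .
  qed
  ultimately show "\<exists>d>0. \<forall>y. norm (y - x) < d \<longrightarrow> norm (f y - f x - D (y - x)) \<le> e * norm (y - x)"
    by blast
qed

section \<open>The unit ball of the space of holomorphic Lipschitz functions\<close>

lemma hl0_eqI:
  assumes "\<And>x. x \<in> ball 0 1 \<Longrightarrow> hl0_apply f x = hl0_apply g x"
  shows "f = g"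
proof -
  have "hl0_apply f = hl0_apply g"
    using assms hl0_apply_eq_0 by (metis ext)
  then show ?thesis by (simp add: hl0_apply_inject)
qed

lemma norm_hl0_le: "C-lipschitz_on (ball 0 1) (hl0_apply f) \<Longrightarrow> norm f \<le> C"
  unfolding norm_hl0.rep_eq by (rule lipschitz_const_le)

lemma norm_hl0_apply_diff_le:
  "x \<in> ball 0 1 \<Longrightarrow> y \<in> ball 0 1 \<Longrightarrow> norm (hl0_apply f x - hl0_apply f y) \<le> norm f * norm (x - y)"
  using lipschitz_onD[OF lipschitz_on_hl0_apply] by (simp add: dist_norm)

lemma norm_hl0_apply_le: "norm (hl0_apply f x) \<le> norm f * norm x"
  using norm_hl0_apply_diff_le[of x 0 f] hl0_apply_eq_0[of x f]
  by (cases "x \<in> ball 0 1") (auto simp: hl0_apply_0)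

lemma cholomorphic_on_hl0_apply: "hl0_apply f cholomorphic_on ball 0 1"
  using hl0_apply[of f] unfolding HL0_set_def by blast

text \<open>The restriction of \<open>f\<close> to the ball as an element of the function space. It is meaningful for
  holomorphic Lipschitz \<open>f\<close> with \<open>f 0 = 0\<close>, in particular for bounded complex linear maps.\<close>

definition hl0_of :: "('a::complex_normed_vector \<Rightarrow> 'b::complex_normed_vector) \<Rightarrow> ('a, 'b) hl0"
  where "hl0_of f = Abs_hl0 (\<lambda>x. if x \<in> ball 0 1 then f x else 0)"

lemma
  assumes hol: "f cholomorphic_on ball 0 1" and lip: "C-lipschitz_on (ball 0 1) f" and "f 0 = 0"
  shows hl0_apply_hl0_of: "x \<in> ball 0 1 \<Longrightarrow> hl0_apply (hl0_of f) x = f x"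
    and norm_hl0_of_le: "norm (hl0_of f) \<le> C"
proof -
  let ?g = "\<lambda>x. if x \<in> ball 0 1 then f x else 0"
  have lip': "C-lipschitz_on (ball 0 1) ?g"
    using lip by (rule lipschitz_on_transform) simp
  have "?g cholomorphic_on ball 0 1"
    unfolding cholomorphic_on_def
  proof
    fix x :: 'a assume x: "x \<in> ball 0 1"
    then obtain D where D: "clinear D" "(f has_derivative D) (at x within ball 0 1)"
      using hol unfolding cholomorphic_on_def by blast
    have "(?g has_derivative D) (at x within ball 0 1)"
      by (rule has_derivative_transform[OF x _ D(2)]) simp
    with D(1) show "\<exists>D. clinear D \<and> (?g has_derivative D) (at x within ball 0 1)"
      by blast
  qed
  then have "?g \<in> HL0_set"
    unfolding HL0_set_def using lip' \<open>f 0 = 0\<close> by auto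
  then have eq: "hl0_apply (hl0_of f) = ?g"
    unfolding hl0_of_def by (rule Abs_hl0_inverse)
  then show "x \<in> ball 0 1 \<Longrightarrow> hl0_apply (hl0_of f) x = f x" by simp
  show "norm (hl0_of f) \<le> C"
    by (rule norm_hl0_le) (simp only: eq lip')
qed

text \<open>Tychonoff's theorem for a product of discs.\<close>

lemma compact_coordinate_box:
  fixes r :: "'i \<Rightarrow> real"
  shows "compact {g. \<forall>i. cmod (g i) \<le> r i}"
proof -
  have "compactin (product_topology (\<lambda>i. euclidean) UNIV) (PiE UNIV (\<lambda>i. cball (0::complex) (r i)))"
    unfolding compactin_PiE by simp
  moreover have "PiE UNIV (\<lambda>i. cball (0::complex) (r i)) = {g. \<forall>i. cmod (g i) \<le> r i}"
    by (auto simp: PiE_def Pi_def)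
  ultimately show ?thesis
    by (simp add: euclidean_product_topology)
qed

text \<open>The functions of norm at most \<open>K\<close> form a compact set for pointwise convergence, because the
  pairs of such a function and its derivative are cut out of a product of discs by closed conditions
  that involve finitely many coordinates each. Differentiability itself is not of this kind, but
  the uniform remainder estimate of lemma \<open>lipschitz_second_order\<close> is.\<close>

lemma compact_hl0_cball:
  assumes K: "0 \<le> K"
  shows "compact (hl0_apply ` {g :: ('a::complex_normed_vector, complex) hl0. norm g \<le> K})"
proof -
  define U where "U = {z :: ('a \<Rightarrow> complex) \<times> ('a \<times> 'a \<Rightarrow> complex).
    (\<forall>x. x \<notin> ball 0 1 \<longrightarrow> fst z x = 0) \<and> fst z 0 = 0 \<and>
    (\<forall>x y. x \<in> ball 0 1 \<and> y \<in> ball 0 1 \<longrightarrow> cmod (fst z x - fst z y) \<le> K * norm (x - y)) \<and>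
    (\<forall>x h k. snd z (x, h + k) = snd z (x, h) + snd z (x, k)) \<and>
    (\<forall>x c h. snd z (x, c *\<^sub>C h) = c * snd z (x, h)) \<and>
    (\<forall>x h. cmod (snd z (x, h)) \<le> K * norm h) \<and>
    (\<forall>x h. x \<in> ball 0 1 \<and> norm h < 1 - norm x \<longrightarrow>
       cmod (fst z (x + h) - fst z x - snd z (x, h)) \<le> 2 * K * (norm h)\<^sup>2 / (1 - norm x))}"
  have cont1: "continuous_on UNIV (\<lambda>z :: ('a \<Rightarrow> complex) \<times> ('a \<times> 'a \<Rightarrow> complex). fst z x)" for x
    by (rule continuous_on_compose2[OF continuous_on_product_coordinates
          continuous_on_fst[OF continuous_on_id] subset_UNIV])
  have cont2: "continuous_on UNIV (\<lambda>z :: ('a \<Rightarrow> complex) \<times> ('a \<times> 'a \<Rightarrow> complex). snd z p)" for p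
    by (rule continuous_on_compose2[OF continuous_on_product_coordinates
          continuous_on_snd[OF continuous_on_id] subset_UNIV])
  have "closed U"
    unfolding U_def
    by (intro closed_Collect_conj closed_Collect_all closed_Collect_imp closed_Collect_le
        closed_Collect_eq continuous_intros cont1 cont2) simp_all
  moreover have "U \<subseteq> {g. \<forall>x. cmod (g x) \<le> K} \<times> {D. \<forall>p. cmod (D p) \<le> K * norm (snd p)}"
  proof
    fix z assume z: "z \<in> U"
    have "cmod (fst z x) \<le> K" for x
    proof (cases "x \<in> ball 0 1")
      case True
      have "x \<in> ball 0 1 \<and> 0 \<in> ball (0::'a) 1 \<longrightarrow> cmod (fst z x - fst z 0) \<le> K * norm (x - 0)"
        using z unfolding U_def mem_Collect_eq by blast
      then have "cmod (fst z x - fst z 0) \<le> K * norm (x - 0)"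
        using True by simp
      also have "\<dots> \<le> K * 1"
        using True K by (intro mult_mono) auto
      finally show ?thesis using z by (simp add: U_def)
    qed (use z K in \<open>simp add: U_def\<close>)
    then show "z \<in> {g. \<forall>x. cmod (g x) \<le> K} \<times> {D. \<forall>p. cmod (D p) \<le> K * norm (snd p)}"
      using z by (auto simp: U_def mem_Times_iff)
  qed
  moreover have "compact ({g :: 'a \<Rightarrow> complex. \<forall>x. cmod (g x) \<le> K} \<times>
      {D :: 'a \<times> 'a \<Rightarrow> complex. \<forall>p. cmod (D p) \<le> K * norm (snd p)})"
    (is "compact ?B")
    by (intro compact_Times compact_coordinate_box)
  ultimately have "compact U"
  proof -
    assume "closed U" and sub: "U \<subseteq> ?B" and "compact ?B"
    then have "compact (?B \<inter> U)" by (intro compact_Int_closed)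
    then show "compact U" unfolding Int_absorb1[OF sub] .
  qed
  then have "compact (fst ` U)"
    by (rule compact_continuous_image[OF continuous_on_fst[OF continuous_on_id]])
  moreover have "fst ` U = hl0_apply ` {g. norm g \<le> K}"
  proof (intro equalityI subsetI)
    fix g assume "g \<in> fst ` U"
    then obtain D where U: "(g, D) \<in> U" by force
    have off: "g x = 0" if "x \<notin> ball 0 1" for x
      using U that unfolding U_def by simp
    have g0: "g 0 = 0"
      using U unfolding U_def by simp
    have diff: "cmod (g x - g y) \<le> K * norm (x - y)" if "x \<in> ball 0 1" "y \<in> ball 0 1" for x y
      using U that unfolding U_def by simp
    have D: "clinear (\<lambda>h. D (x, h))" "cmod (D (x, h)) \<le> K * norm h" for x h
      using U unfolding U_def by (simp_all add: clinear_iff scaleC_complex_def)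
    have quad: "cmod (g (x + h) - g x - D (x, h)) \<le> 2 * K / (1 - norm x) * (norm h)\<^sup>2"
      if "x \<in> ball 0 1" "norm h < 1 - norm x" for x h
      using U that unfolding U_def by simp
    have "g cholomorphic_on ball 0 1"
      unfolding cholomorphic_on_def
    proof
      fix x :: 'a assume x: "x \<in> ball 0 1"
      have "(g has_derivative (\<lambda>h. D (x, h))) (at x)"
        by (rule has_derivative_quadratic[OF clinear_imp_bounded_linear[OF D] _ quad[OF x]])
          (use x in auto)
      then show "\<exists>D. clinear D \<and> (g has_derivative D) (at x within ball 0 1)"
        using D(1) has_derivative_at_withinI by blast
    qed
    moreover have "K-lipschitz_on (ball 0 1) g"
      using K diff by (auto intro!: lipschitz_onI simp: dist_norm)
    ultimately have g: "hl0_apply (hl0_of g) x = g x" "norm (hl0_of g) \<le> K" if "x \<in> ball 0 1" for x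
      using that by (simp_all add: hl0_apply_hl0_of norm_hl0_of_le g0)
    have "hl0_apply (hl0_of g) = g"
      using g(1) off hl0_apply_eq_0 by (metis ext)
    then show "g \<in> hl0_apply ` {g. norm g \<le> K}"
      using g(2)[of 0] by (metis (mono_tags, lifting) centre_in_ball imageI mem_Collect_eq zero_less_one)
  next
    fix f :: "'a \<Rightarrow> complex" assume "f \<in> hl0_apply ` {g. norm g \<le> K}"
    then obtain g :: "('a, complex) hl0" where g: "f = hl0_apply g" "norm g \<le> K" by blast
    have lip: "K-lipschitz_on (ball 0 1) f"
      unfolding g(1) using lipschitz_on_hl0_apply g(2) by (rule lipschitz_on_le)
    have "\<exists>D. clinear D \<and> (f has_derivative D) (at x)" if "x \<in> ball 0 1" for x
      unfolding g(1) using hl0_apply_has_derivative[OF that] by metis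
    then obtain D where D: "\<And>x. x \<in> ball 0 1 \<Longrightarrow> clinear (D x) \<and> (f has_derivative D x) (at x)"
      by metis
    define E where "E p = (if fst p \<in> ball 0 1 then D (fst p) (snd p) else 0)" for p
    have "(f, E) \<in> U"
      unfolding U_def mem_Collect_eq fst_conv snd_conv
    proof (intro conjI allI impI)
      fix x h k :: 'a and c :: complex
      show "f x = 0" if "x \<notin> ball 0 1"
        using hl0_apply_eq_0[OF that] g(1) by simp
      show "f 0 = 0" using g(1) by (simp add: hl0_apply_0)
      show "cmod (f x - f h) \<le> K * norm (x - h)" if "x \<in> ball 0 1 \<and> h \<in> ball 0 1"
        using lipschitz_onD[OF lip] that by (auto simp: dist_norm)
      show "E (x, h + k) = E (x, h) + E (x, k)" "E (x, c *\<^sub>C h) = c * E (x, h)"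
        using D[of x] by (auto simp: E_def clinear_iff scaleC_complex_def)
      show "cmod (E (x, h)) \<le> K * norm h"
        using has_derivative_lipschitz_bound[OF lip open_ball] D[of x] K by (auto simp: E_def)
      show "cmod (f (x + h) - f x - E (x, h)) \<le> 2 * K * (norm h)\<^sup>2 / (1 - norm x)"
        if "x \<in> ball 0 1 \<and> norm h < 1 - norm x"
        using lipschitz_second_order[of f K "D x" x h] cholomorphic_on_hl0_apply[of g] lip D[of x] that
        by (simp add: E_def g(1))
    qed
    then show "f \<in> fst ` U" by force
  qed
  ultimately show ?thesis by simp
qed

text \<open>If the values on \<open>P\<close> determine the value at \<open>x\<close>, then on norm-bounded sets compactness makes
  this dependence at \<open>0\<close> continuous and reduces it to finitely many points of \<open>P\<close>.\<close>

lemma hl0_small_on_finite_set: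
  fixes x :: "'a::complex_normed_vector"
  assumes K: "0 \<le> K" and e: "0 < e"
    and unique: "\<And>g :: ('a, complex) hl0. (\<And>p. p \<in> P \<Longrightarrow> hl0_apply g p = 0) \<Longrightarrow> hl0_apply g x = 0"
  obtains F d where "finite F" "F \<subseteq> P" "0 < d"
    "\<forall>g :: ('a, complex) hl0. norm g \<le> K \<longrightarrow> (\<forall>p\<in>F. cmod (hl0_apply g p) \<le> d) \<longrightarrow>
      cmod (hl0_apply g x) < e"
proof -
  define A where "A = hl0_apply ` {g :: ('a, complex) hl0. norm g \<le> K} \<inter> {f. e \<le> cmod (f x)}"
  define W where "W = (\<lambda>(p, d). {f :: 'a \<Rightarrow> complex. d < cmod (f p)})"
  have "compact A"
    unfolding A_def
    by (intro compact_Int_closed compact_hl0_cball K closed_Collect_le continuous_intros) simp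
  moreover have "open (W c)" if "c \<in> P \<times> {0<..}" for c
    unfolding W_def by (auto split: prod.split intro!: open_Collect_less continuous_intros)
  moreover have "A \<subseteq> (\<Union>c\<in>P \<times> {0<..}. W c)"
  proof
    fix f assume "f \<in> A"
    then obtain g :: "('a, complex) hl0" where g: "f = hl0_apply g" "e \<le> cmod (f x)"
      unfolding A_def by auto
    then obtain p where p: "p \<in> P" "f p \<noteq> 0"
      using unique[of g] e by (metis norm_zero not_le)
    then have "f \<in> W (p, cmod (f p) / 2)"
      by (simp add: W_def)
    with p show "f \<in> (\<Union>c\<in>P \<times> {0<..}. W c)"
      by (intro UN_I[of "(p, cmod (f p) / 2)"]) auto
  qed
  ultimately obtain C where C: "C \<subseteq> P \<times> {0<..}" "finite C" "A \<subseteq> (\<Union>c\<in>C. W c)"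
    by (rule compactE_image)
  define d where "d = Min (insert 1 (snd ` C))"
  have fin: "finite (insert 1 (snd ` C))" using C(2) by simp
  show thesis
  proof (rule that)
    show "finite (fst ` C)" "fst ` C \<subseteq> P" using C by auto
    show "0 < d" unfolding d_def using C(1) by (subst Min_gr_iff[OF fin]) auto
    show "\<forall>g :: ('a, complex) hl0. norm g \<le> K \<longrightarrow> (\<forall>p\<in>fst ` C. cmod (hl0_apply g p) \<le> d) \<longrightarrow>
        cmod (hl0_apply g x) < e"
    proof (intro allI impI, rule ccontr)
      fix g :: "('a, complex) hl0"
      assume g: "norm g \<le> K" "\<forall>p\<in>fst ` C. cmod (hl0_apply g p) \<le> d"
        and "\<not> cmod (hl0_apply g x) < e"
      then have "hl0_apply g \<in> A" by (auto simp: A_def)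
      then obtain c where c: "c \<in> C" "snd c < cmod (hl0_apply g (fst c))"
        using C(3) by (fastforce simp: W_def)
      moreover have "d \<le> snd c"
        unfolding d_def using fin c(1) by (intro Min_le) auto
      ultimately show False using g(2) by force
    qed
  qed
qed

text \<open>A weakly holomorphic map into a Banach space is holomorphic: by the uniform remainder
  estimate the difference quotients form a norm Cauchy sequence.\<close>

lemma weakly_hl0_imp_hl0:
  fixes \<psi> :: "'a::complex_normed_vector \<Rightarrow> 'b::complex_banach"
  assumes weak: "\<And>l. l \<in> dual_ball \<Longrightarrow>
      \<exists>g :: ('a, complex) hl0. norm g \<le> K \<and> (\<forall>x\<in>ball 0 1. hl0_apply g x = l (\<psi> x))"
  shows "K-lipschitz_on (ball 0 1) \<psi>" and "\<psi> cholomorphic_on ball 0 1"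
proof -
  obtain g :: "('b \<Rightarrow> complex) \<Rightarrow> ('a, complex) hl0"
    where g: "\<And>l. l \<in> dual_ball \<Longrightarrow> norm (g l) \<le> K"
      "\<And>l x. l \<in> dual_ball \<Longrightarrow> x \<in> ball 0 1 \<Longrightarrow> hl0_apply (g l) x = l (\<psi> x)"
    using weak by metis
  have "(\<lambda>_. 0) \<in> (dual_ball :: ('b \<Rightarrow> complex) set)"
    by (simp add: dual_ball_def clinear_iff)
  then have K: "0 \<le> K" using g(1) norm_ge_zero order_trans by blast
  have lip: "K-lipschitz_on (ball 0 1) (hl0_apply (g l))" if "l \<in> dual_ball" for l
    using lipschitz_on_hl0_apply g(1)[OF that] by (rule lipschitz_on_le)
  show "K-lipschitz_on (ball 0 1) \<psi>"
  proof (rule lipschitz_onI[OF _ K])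
    fix x y :: 'a assume xy: "x \<in> ball 0 1" "y \<in> ball 0 1"
    have "norm (\<psi> x - \<psi> y) \<le> K * norm (x - y)"
    proof (rule norm_le_dual_ball)
      fix l :: "'b \<Rightarrow> complex" assume l: "l \<in> dual_ball"
      show "cmod (l (\<psi> x - \<psi> y)) \<le> K * norm (x - y)"
        using lipschitz_onD[OF lip[OF l] xy] g(2)[OF l] xy
        by (simp add: dist_norm dual_ball_diff[OF l])
    qed
    then show "dist (\<psi> x) (\<psi> y) \<le> K * dist x y" by (simp add: dist_norm)
  qed
  show "\<psi> cholomorphic_on ball 0 1"
    unfolding cholomorphic_on_def
  proof
    fix x :: 'a assume x: "x \<in> ball 0 1"
    define r where "r = 1 - norm x"
    have r: "0 < r" using x by (simp add: r_def)
    have "\<exists>D. clinear D \<and> (hl0_apply (g l) has_derivative D) (at x)" for l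
      using hl0_apply_has_derivative[OF x] by metis
    then obtain E where E: "\<And>l. clinear (E l)" "\<And>l. (hl0_apply (g l) has_derivative E l) (at x)"
      by metis
    have Ebound: "cmod (E l h) \<le> K * norm h" if "l \<in> dual_ball" for l h
      by (rule has_derivative_lipschitz_bound[OF lip[OF that] open_ball x E(2)])
    have in_ball: "x + h \<in> ball 0 1" if "norm h < r" for h
      using that norm_triangle_ineq[of x h] by (simp add: r_def)
    have quad: "cmod (l (\<psi> (x + h) - \<psi> x) - E l h) \<le> 2 * K / r * (norm h)\<^sup>2"
      if l: "l \<in> dual_ball" and h: "norm h < r" for l h
      using lipschitz_second_order[OF cholomorphic_on_hl0_apply lip[OF l] E x, of h] h
        g(2)[OF l x] g(2)[OF l in_ball[OF h]]
      by (simp add: r_def dual_ball_diff[OF l])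
    have "\<exists>d. \<forall>l\<in>dual_ball. l d = E l h" for h
    proof -
      define t where "t n = r / (norm h + 1) / real (Suc n)" for n
      have t: "0 < t n" for n
        using r by (simp add: t_def add_nonneg_pos)
      have "t n * (norm h + 1) \<le> r" for n
        using r by (simp add: t_def add_nonneg_pos divide_le_eq)
      moreover have "t n * norm h < t n * (norm h + 1)" for n
        using t by simp
      ultimately have th: "norm (t n *\<^sub>R h) < r" for n
        using t[of n] by (simp add: abs_of_pos) (meson le_less_trans less_le_trans)
      have t0: "t \<longlonglongrightarrow> 0"
        unfolding t_def by (rule LIMSEQ_Suc, rule lim_const_over_n)
      define q where "q n = inverse (t n) *\<^sub>R (\<psi> (x + t n *\<^sub>R h) - \<psi> x)" for n
      define c where "c = 2 * K / r * (norm h)\<^sup>2"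
      have q: "cmod (l (q n) - E l h) \<le> c * t n" if l: "l \<in> dual_ball" for l n
      proof -
        have "l (q n) - E l h
            = inverse (t n) *\<^sub>R (l (\<psi> (x + t n *\<^sub>R h) - \<psi> x) - E l (t n *\<^sub>R h))"
        proof -
          have "l (q n) = inverse (t n) *\<^sub>R l (\<psi> (x + t n *\<^sub>R h) - \<psi> x)"
            unfolding q_def using l by (simp only: dual_ball_def mem_Collect_eq clinear_scaleR)
          moreover have "E l (t n *\<^sub>R h) = t n *\<^sub>R E l h"
            using E(1) by (rule clinear_scaleR)
          ultimately show ?thesis
            using t[of n] by (simp only: scaleR_diff_right) simp
        qed
        then have "cmod (l (q n) - E l h)
            = inverse (t n) * cmod (l (\<psi> (x + t n *\<^sub>R h) - \<psi> x) - E l (t n *\<^sub>R h))"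
          using t[of n] by (simp only: norm_scaleR) simp
        also have "\<dots> \<le> inverse (t n) * (2 * K / r * (norm (t n *\<^sub>R h))\<^sup>2)"
          using t[of n] by (intro mult_left_mono quad[OF l th]) simp
        also have "\<dots> = c * t n"
          using t[of n] by (simp add: c_def power2_eq_square field_simps)
        finally show ?thesis .
      qed
      have "norm (q n - q m) \<le> c * t n + c * t m" for n m
      proof (rule norm_le_dual_ball)
        fix l :: "'b \<Rightarrow> complex" assume l: "l \<in> dual_ball"
        have "l (q n - q m) = (l (q n) - E l h) - (l (q m) - E l h)"
          by (simp add: dual_ball_diff[OF l])
        then show "cmod (l (q n - q m)) \<le> c * t n + c * t m"
          using q[OF l, of n] q[OF l, of m] norm_triangle_ineq4[of "l (q n) - E l h" "l (q m) - E l h"]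
          by simp
      qed
      moreover have ct0: "(\<lambda>n. c * t n) \<longlonglongrightarrow> 0"
        using tendsto_mult_left[OF t0, of c] by simp
      ultimately have "Cauchy q"
      proof -
        assume qq: "\<And>n m. norm (q n - q m) \<le> c * t n + c * t m"
        show "Cauchy q"
        proof (rule CauchyI)
          fix e :: real assume "0 < e"
          then have "\<forall>\<^sub>F n in sequentially. c * t n < e / 2"
            using order_tendstoD(2)[OF ct0, of "e / 2"] by simp
          then obtain N where "\<And>n. n \<ge> N \<Longrightarrow> c * t n < e / 2"
            unfolding eventually_sequentially by blast
          then show "\<exists>N. \<forall>m\<ge>N. \<forall>n\<ge>N. norm (q m - q n) < e"
            using qq by (intro exI[of _ N]) (smt (verit) field_sum_of_halves)
        qed
      qed
      then obtain d where d: "q \<longlonglongrightarrow> d"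
        by (auto simp: Cauchy_convergent_iff convergent_def)
      have "l d = E l h" if l: "l \<in> dual_ball" for l
      proof (rule LIMSEQ_unique)
        show "(\<lambda>n. l (q n)) \<longlonglongrightarrow> l d"
          by (rule bounded_linear.tendsto[OF dual_ball_bounded_linear[OF l] d])
        have "(\<lambda>n. l (q n) - E l h) \<longlonglongrightarrow> 0"
          by (rule Lim_null_comparison[OF _ ct0]) (simp add: q[OF l])
        then show "(\<lambda>n. l (q n)) \<longlonglongrightarrow> E l h"
          by (simp add: LIM_zero_iff)
      qed
      then show ?thesis by blast
    qed
    then obtain D where D: "\<And>l h. l \<in> dual_ball \<Longrightarrow> l (D h) = E l h"
      by metis
    have "clinear D"
      unfolding clinear_iff
    proof (intro conjI allI)
      fix h k and c :: complex
      show "D (h + k) = D h + D k"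
      proof (rule eq_dual_ball)
        fix l :: "'b \<Rightarrow> complex" assume l: "l \<in> dual_ball"
        show "l (D (h + k)) = l (D h + D k)"
          using E(1)[of l] unfolding dual_ball_add[OF l] D[OF l] clinear_iff by blast
      qed
      show "D (c *\<^sub>C h) = c *\<^sub>C D h"
      proof (rule eq_dual_ball)
        fix l :: "'b \<Rightarrow> complex" assume l: "l \<in> dual_ball"
        show "l (D (c *\<^sub>C h)) = l (c *\<^sub>C D h)"
          using E(1)[of l] unfolding dual_ball_scaleC[OF l] D[OF l] clinear_iff scaleC_complex_def
          by blast
      qed
    qed
    moreover have "norm (D h) \<le> K * norm h" for h
    proof (rule norm_le_dual_ball)
      fix l :: "'b \<Rightarrow> complex" assume l: "l \<in> dual_ball"
      show "cmod (l (D h)) \<le> K * norm h"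
        using Ebound[OF l] unfolding D[OF l] .
    qed
    ultimately have "bounded_linear D"
      by (rule clinear_imp_bounded_linear)
    moreover have "norm (\<psi> (x + h) - \<psi> x - D h) \<le> 2 * K / r * (norm h)\<^sup>2" if h: "norm h < r" for h
    proof (rule norm_le_dual_ball)
      fix l :: "'b \<Rightarrow> complex" assume l: "l \<in> dual_ball"
      show "cmod (l (\<psi> (x + h) - \<psi> x - D h)) \<le> 2 * K / r * (norm h)\<^sup>2"
        using quad[OF l h] unfolding dual_ball_diff[OF l, of _ "D h"] D[OF l] .
    qed
    ultimately have "(\<psi> has_derivative D) (at x)"
      using r by (intro has_derivative_quadratic)
    then show "\<exists>D. clinear D \<and> (\<psi> has_derivative D) (at x within ball 0 1)"
      using \<open>clinear D\<close> has_derivative_at_withinI by blast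
  qed
qed

section \<open>Cartan's uniqueness theorem\<close>

lemma Schwarz_order_ball:
  fixes f :: "'a::complex_normed_vector \<Rightarrow> 'b::complex_normed_vector"
  assumes hol: "f cholomorphic_on ball 0 1" and bound: "\<And>z. z \<in> ball 0 1 \<Longrightarrow> norm (f z) \<le> M"
    and f0: "f 0 = 0"
    and small: "\<And>e. 0 < e \<Longrightarrow> \<forall>\<^sub>F \<zeta> in at 0. norm (f (\<zeta> *\<^sub>C z)) \<le> e * cmod \<zeta> ^ n"
    and z: "z \<in> ball 0 1"
  shows "norm (f z) \<le> M * norm z ^ Suc n"
proof (cases "z = 0")
  case False
  have map: "0 + \<zeta> *\<^sub>C z \<in> ball 0 1" if "\<zeta> \<in> ball 0 (1 / norm z)" for \<zeta>
    using that False by (simp add: norm_scaleC field_simps)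
  have "norm (f (0 + 1 *\<^sub>C z)) \<le> M * (cmod 1 / (1 / norm z)) ^ Suc n"
    using z False map
    by (intro Schwarz_order[where Q = "\<lambda>\<zeta>. f (0 + \<zeta> *\<^sub>C z)" and R = "1 / norm z"]
        cholomorphic_on_compose[OF cholomorphic_on_line hol] bound)
      (auto simp: small)
  then show ?thesis by simp
qed (simp add: f0)

lemma Schwarz_ball:
  fixes f :: "'a::complex_normed_vector \<Rightarrow> 'b::complex_normed_vector"
  assumes hol: "f cholomorphic_on ball 0 1" and bound: "\<And>z. z \<in> ball 0 1 \<Longrightarrow> norm (f z) \<le> M"
    and f0: "f 0 = 0" and z: "z \<in> ball 0 1"
  shows "norm (f z) \<le> M * norm z"
proof -
  have "norm (f z) \<le> M * norm z ^ Suc 0"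
  proof (rule Schwarz_order_ball[OF hol bound f0 _ z])
    obtain D where "(f has_derivative D) (at 0 within ball 0 1)"
      using hol unfolding cholomorphic_on_def by force
    then have "isCont f 0"
      using has_derivative_continuous at_within_open[of "0::'a" "ball 0 1"] by fastforce
    moreover have "isCont (\<lambda>\<zeta>. \<zeta> *\<^sub>C z) 0"
    proof -
      have "bounded_linear (\<lambda>\<zeta>. \<zeta> *\<^sub>C z)"
        by (rule clinear_imp_bounded_linear[where K = "norm z"])
          (simp_all add: clinear_iff scaleC_add_left scaleC_complex_def norm_scaleC mult.commute)
      then show ?thesis by (rule linear_continuous_at)
    qed
    ultimately have "isCont (\<lambda>\<zeta>. f (\<zeta> *\<^sub>C z)) 0"
      using isCont_o2[where f = "\<lambda>\<zeta>. \<zeta> *\<^sub>C z" and g = f and a = 0] by simp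
    then have lim: "((\<lambda>\<zeta>. f (\<zeta> *\<^sub>C z)) \<longlongrightarrow> 0) (at 0)"
      by (simp add: isCont_def f0)
    fix e :: real assume "0 < e"
    with lim have "\<forall>\<^sub>F \<zeta> in at 0. norm (f (\<zeta> *\<^sub>C z)) < e"
      by (auto simp: tendsto_iff dist_norm)
    then show "\<forall>\<^sub>F \<zeta> in at 0. norm (f (\<zeta> *\<^sub>C z)) \<le> e * cmod \<zeta> ^ 0"
      by (auto elim: eventually_mono)
  qed
  then show ?thesis by simp
qed

text \<open>The leading constant of a zero of order \<open>n\<close> can be replaced by the supremum norm.\<close>

lemma Schwarz_bigO_ball:
  fixes f :: "'a::complex_normed_vector \<Rightarrow> 'b::complex_normed_vector"
  assumes hol: "f cholomorphic_on ball 0 1" and bound: "\<And>z. z \<in> ball 0 1 \<Longrightarrow> norm (f z) \<le> M"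
    and O: "\<And>z. z \<in> ball 0 1 \<Longrightarrow> norm (f z) \<le> C * norm z ^ n"
    and z: "z \<in> ball 0 1"
  shows "norm (f z) \<le> M * norm z ^ n"
proof (cases n)
  case 0
  then show ?thesis using bound[OF z] by simp
next
  case (Suc m)
  have f0: "f 0 = 0" using O[of 0] Suc by simp
  have "norm (f z) \<le> M * norm z ^ Suc m"
  proof (rule Schwarz_order_ball[OF hol bound f0 _ z])
    fix e :: real assume e: "0 < e"
    define d where "d = min 1 (e / (\<bar>C\<bar> + 1))"
    have pos: "0 < \<bar>C\<bar> + 1" by simp
    have "norm (f (\<zeta> *\<^sub>C z)) \<le> e * cmod \<zeta> ^ m" if d: "cmod \<zeta> < d" for \<zeta>
    proof -
      have le: "norm (\<zeta> *\<^sub>C z) \<le> cmod \<zeta>"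
        using z by (simp add: norm_scaleC mult_left_le)
      then have "norm (f (\<zeta> *\<^sub>C z)) \<le> C * norm (\<zeta> *\<^sub>C z) ^ n"
        using d by (intro O) (simp add: d_def)
      also have "\<dots> \<le> (\<bar>C\<bar> + 1) * cmod \<zeta> ^ n"
        using le by (intro mult_mono power_mono) auto
      also have "\<dots> = (\<bar>C\<bar> + 1) * cmod \<zeta> * cmod \<zeta> ^ m"
        by (simp add: Suc)
      also have "\<dots> \<le> e * cmod \<zeta> ^ m"
        using d pos by (intro mult_right_mono) (simp_all add: d_def field_simps)
      finally show ?thesis .
    qed
    moreover have "0 < d" using e by (simp add: d_def)
    ultimately show "\<forall>\<^sub>F \<zeta> in at 0. norm (f (\<zeta> *\<^sub>C z)) \<le> e * cmod \<zeta> ^ m"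
      unfolding eventually_at by (intro exI[of _ d]) auto
  qed
  then show ?thesis by (simp add: Suc)
qed

text \<open>Write \<open>F z = z + R z\<close>. If \<open>R z = O(\<parallel>z\<parallel>\<^sup>m)\<close>, then the \<open>k\<close>-th iterate is
  \<open>z + k R z + O(\<parallel>z\<parallel>\<^sup>m\<^sup>+\<^sup>1)\<close>, because \<open>R\<close> vanishes to second order and so hardly changes under
  the small displacement by an iterate. The iterates stay in the unit ball, so by the Schwarz lemma
  they differ from \<open>z\<close> by at most \<open>2 \<parallel>z\<parallel>\<^sup>m\<close>, independently of \<open>k\<close>. Hence \<open>k \<parallel>R z\<parallel>\<close> is at most
  \<open>2 \<parallel>z\<parallel>\<^sup>m\<close> up to higher order for every \<open>k\<close>, that is \<open>R z = o(\<parallel>z\<parallel>\<^sup>m)\<close>, and the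
  Schwarz lemma turns this into \<open>\<parallel>R z\<parallel> \<le> 2 \<parallel>z\<parallel>\<^sup>m\<^sup>+\<^sup>1\<close>. As the constant \<open>2\<close> stays fixed, letting
  \<open>m\<close> tend to infinity gives \<open>R = 0\<close>.\<close>

lemma Cartan_uniqueness:
  fixes F :: "'a::complex_normed_vector \<Rightarrow> 'a"
  assumes hol: "F cholomorphic_on ball 0 1" and lip: "K-lipschitz_on (ball 0 1) F"
    and self: "F ` ball 0 1 \<subseteq> ball 0 1" and F0: "F 0 = 0"
    and deriv: "(F has_derivative (\<lambda>h. h)) (at 0)" and z: "z \<in> ball 0 1"
  shows "F z = z"
proof -
  define R where "R z = F z - z" for z
  define L where "L = K + 1"
  have F_in: "F z \<in> ball 0 1" if "z \<in> ball 0 1" for z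
    using self that by blast
  have F_le: "norm (F z) \<le> norm z" if "z \<in> ball 0 1" for z
    using Schwarz_ball[OF hol _ F0 that, of 1] F_in by (simp add: less_imp_le)
  have idhol: "(\<lambda>z::'a. z) cholomorphic_on ball 0 1"
    by (intro cholomorphic_on_linear) (simp_all add: clinear_iff bounded_linear_ident)
  have R_hol: "R cholomorphic_on ball 0 1"
    unfolding R_def by (intro cholomorphic_on_diff hol idhol)
  have R0: "R 0 = 0" by (simp add: R_def F0)
  have R_lip: "norm (R z - R w) \<le> L * norm (z - w)" if "z \<in> ball 0 1" "w \<in> ball 0 1" for z w
    using lipschitz_onD[OF lip that] norm_triangle_ineq4[of "F z - F w" "z - w"]
    by (simp add: R_def L_def dist_norm algebra_simps)
  have L: "0 \<le> L" using lipschitz_on_nonneg[OF lip] by (simp add: L_def)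
  have R_deriv: "(R has_derivative (\<lambda>_. 0)) (at 0)"
    unfolding R_def using has_derivative_diff[OF deriv has_derivative_ident] by simp
  have R_diff: "norm (R z - R w) \<le> L * max (norm z) (norm w) * norm (z - w)"
    if z: "z \<in> ball 0 1" and w: "w \<in> ball 0 1" for z w
  proof (cases "z = 0 \<and> w = 0")
    case False
    define m where "m = max (norm z) (norm w)"
    have m: "0 < m" "m < 1" "norm z \<le> m" "norm w \<le> m"
      using False z w by (auto simp: m_def less_max_iff_disj)
    define Q where "Q \<zeta> = R (0 + \<zeta> *\<^sub>C z) - R (0 + \<zeta> *\<^sub>C w)" for \<zeta>
    have in_ball: "0 + \<zeta> *\<^sub>C v \<in> ball 0 1" if "\<zeta> \<in> ball 0 (1 / m)" "norm v \<le> m" for \<zeta> v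
    proof -
      have "cmod \<zeta> * norm v \<le> cmod \<zeta> * m" using that by (intro mult_left_mono) auto
      also have "\<dots> < 1" using that m by (simp add: field_simps)
      finally show ?thesis by (simp add: norm_scaleC)
    qed
    \<comment> \<open>The Schwarz lemma of order two on the disc of radius \<open>1 / m\<close>, the largest one on which
      both rays stay in the ball.\<close>
    have "norm (Q 1) \<le> L * norm (z - w) / m * (cmod 1 / (1 / m)) ^ Suc 1"
    proof (rule Schwarz_order)
      show "Q cholomorphic_on ball 0 (1 / m)"
        unfolding Q_def
        by (intro cholomorphic_on_diff cholomorphic_on_compose[OF cholomorphic_on_line R_hol])
          (use in_ball m in blast)+
      show "norm (Q \<zeta>) \<le> L * norm (z - w) / m" if "\<zeta> \<in> ball 0 (1 / m)" for \<zeta>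
      proof -
        have "norm (Q \<zeta>) \<le> L * (cmod \<zeta> * norm (z - w))"
          using R_lip[OF in_ball[OF that m(3)] in_ball[OF that m(4)]]
          by (simp add: Q_def norm_scaleC flip: complex_vector.scale_right_diff_distrib)
        also have "\<dots> \<le> L * (1 / m * norm (z - w))"
          using that L by (intro mult_left_mono mult_right_mono) auto
        finally show ?thesis by simp
      qed
      fix e :: real assume "0 < e"
      then have "0 < e / 2" by simp
      note line = has_derivative_remainder_line[OF R_deriv this]
      from line[of z] line[of w] show "\<forall>\<^sub>F \<zeta> in at 0. norm (Q \<zeta>) \<le> e * cmod \<zeta> ^ 1"
      proof eventually_elim
        case (elim \<zeta>)
        then show ?case
          using norm_triangle_ineq4[of "R (\<zeta> *\<^sub>C z)" "R (\<zeta> *\<^sub>C w)"] by (simp add: Q_def R0)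
      qed
    qed (use m in simp)
    also have "\<dots> = L * m * norm (z - w)"
      using m by (simp add: power2_eq_square)
    finally show ?thesis by (simp add: Q_def m_def)
  qed simp
  have it: "(F ^^ k) z \<in> ball 0 1" "norm ((F ^^ k) z) \<le> norm z" if "z \<in> ball 0 1" for k z
  proof (induction k)
    case (Suc k)
    case 1
    then show ?case using F_in[OF Suc(1)] by simp
    case 2
    then show ?case using F_le[OF Suc(1)] Suc(2) by simp
  qed (use that in simp_all)
  have it_hol: "(F ^^ k) cholomorphic_on ball 0 1" for k
  proof (induction k)
    case (Suc k)
    show ?case
      using cholomorphic_on_compose[OF Suc hol] it(1) by (simp add: o_def image_subset_iff)
  qed (use idhol in \<open>simp add: id_def\<close>)
  have R_order: "\<forall>z\<in>ball 0 1. norm (R z) \<le> 2 * norm z ^ m" for m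
  proof (induction m)
    case 0
    have "norm (R z) \<le> 2" if "z \<in> ball 0 1" for z
      using norm_triangle_ineq4[of "F z" z] F_in[OF that] that by (simp add: R_def)
    then show ?case by simp
  next
    case (Suc m)
    have it_expand: "\<exists>C\<ge>0. \<forall>z\<in>ball 0 1. norm ((F ^^ k) z - z - real k *\<^sub>R R z) \<le> C * norm z ^ Suc m" for k
    proof (induction k)
      case 0
      then show ?case by (intro exI[of _ 0]) simp
    next
      case (Suc k)
      then obtain C where C: "0 \<le> C"
        "\<And>z. z \<in> ball 0 1 \<Longrightarrow> norm ((F ^^ k) z - z - real k *\<^sub>R R z) \<le> C * norm z ^ Suc m"
        by blast
      have "norm ((F ^^ Suc k) z - z - real (Suc k) *\<^sub>R R z) \<le> (C + L * (2 * k + C)) * norm z ^ Suc m"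
        if z: "z \<in> ball 0 1" for z
      proof -
        let ?w = "(F ^^ k) z"
        have "norm z ^ Suc m \<le> norm z ^ m"
          using z by (intro power_decreasing) auto
        then have C': "C * norm z ^ Suc m \<le> C * norm z ^ m"
          using C(1) by (rule mult_left_mono)
        have "norm (?w - z) \<le> norm (?w - z - real k *\<^sub>R R z) + norm (real k *\<^sub>R R z)"
          by (metis diff_add_cancel norm_triangle_ineq)
        also have "\<dots> \<le> C * norm z ^ m + real k * (2 * norm z ^ m)"
          using C(2)[OF z] C' Suc.prems \<open>\<forall>z\<in>ball 0 1. norm (R z) \<le> 2 * norm z ^ m\<close> z
          by (intro add_mono) (auto intro!: mult_left_mono)
        finally have w: "norm (?w - z) \<le> (2 * k + C) * norm z ^ m"
          by (simp add: algebra_simps)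
        have "norm (R ?w - R z) \<le> L * norm z * norm (?w - z)"
          using R_diff[OF it(1)[OF z, of k] z] it(2)[OF z, of k] by (simp add: max_absorb2)
        also have "\<dots> \<le> L * norm z * ((2 * k + C) * norm z ^ m)"
          using w L by (intro mult_left_mono) auto
        finally have RR: "norm (R ?w - R z) \<le> L * (2 * k + C) * norm z ^ Suc m"
          by (simp add: mult_ac)
        have "(F ^^ Suc k) z - z - real (Suc k) *\<^sub>R R z
            = (?w - z - real k *\<^sub>R R z) + (R ?w - R z)"
          by (simp add: R_def algebra_simps)
        then show ?thesis
          using norm_triangle_ineq[of "?w - z - real k *\<^sub>R R z" "R ?w - R z"] C(2)[OF z] RR
          by (simp add: algebra_simps)
      qed
      moreover have "0 \<le> C + L * (2 * k + C)" using C(1) L by simp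
      ultimately show ?case by blast
    qed
    have kR: "\<exists>C\<ge>0. \<forall>z\<in>ball 0 1. real k * norm (R z) \<le> 2 * norm z ^ m + C * norm z ^ Suc m" for k
    proof -
      obtain C where C: "0 \<le> C"
        "\<And>z. z \<in> ball 0 1 \<Longrightarrow> norm ((F ^^ k) z - z - real k *\<^sub>R R z) \<le> C * norm z ^ Suc m"
        using it_expand[of k] by blast
      have "norm ((F ^^ k) z - z) \<le> 2 * norm z ^ m" if "z \<in> ball 0 1" for z
      proof (rule Schwarz_bigO_ball[where f = "\<lambda>z. (F ^^ k) z - z" and C = "2 * k + C"])
        show "(\<lambda>z. (F ^^ k) z - z) cholomorphic_on ball 0 1"
          by (intro cholomorphic_on_diff it_hol idhol)
        show "norm ((F ^^ k) z - z) \<le> 2" if "z \<in> ball 0 1" for z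
          using norm_triangle_ineq4[of "(F ^^ k) z" z] it(1)[OF that, of k] that by simp
        show "norm ((F ^^ k) z - z) \<le> (2 * k + C) * norm z ^ m" if z: "z \<in> ball 0 1" for z
        proof -
          have "norm z ^ Suc m \<le> norm z ^ m"
            using z by (intro power_decreasing) auto
          then have C': "C * norm z ^ Suc m \<le> C * norm z ^ m"
            using C(1) by (rule mult_left_mono)
          have "norm ((F ^^ k) z - z)
              \<le> norm ((F ^^ k) z - z - real k *\<^sub>R R z) + norm (real k *\<^sub>R R z)"
            by (metis diff_add_cancel norm_triangle_ineq)
          also have "\<dots> \<le> C * norm z ^ m + real k * (2 * norm z ^ m)"
            using C(2)[OF z] C' Suc.IH z by (intro add_mono) (auto intro!: mult_left_mono)
          finally show ?thesis by (simp add: algebra_simps)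
        qed
      qed (use that in simp)
      moreover have "norm (real k *\<^sub>R R z)
          \<le> norm ((F ^^ k) z - z) + norm ((F ^^ k) z - z - real k *\<^sub>R R z)" for z
        by (metis norm_triangle_sub norm_minus_commute add.commute)
      ultimately show ?thesis
        using C by (intro exI[of _ C]) (fastforce intro: order_trans)
    qed
    show ?case
    proof
      fix z :: 'a assume z: "z \<in> ball 0 1"
      show "norm (R z) \<le> 2 * norm z ^ Suc m"
      proof (rule Schwarz_order_ball[OF R_hol _ R0 _ z])
        show "norm (R z) \<le> 2" if "z \<in> ball 0 1" for z
          using norm_triangle_ineq4[of "F z" z] F_in[OF that] that by (simp add: R_def)
        fix e :: real assume e: "0 < e"
        \<comment> \<open>\<open>3\<close> is the constant \<open>2\<close> of the leading term plus \<open>1\<close> for the error term on a small disc.\<close>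
        obtain k :: nat where k: "3 / e < k" using reals_Archimedean2 by blast
        then have "0 < k" using e by (metis divide_pos_pos less_trans of_nat_0_less_iff zero_less_numeral)
        obtain C where C: "0 \<le> C"
          "\<And>z. z \<in> ball 0 1 \<Longrightarrow> real k * norm (R z) \<le> 2 * norm z ^ m + C * norm z ^ Suc m"
          using kR[of k] by blast
        define d where "d = 1 / (C + 1)"
        have d: "0 < d" "d \<le> 1" "C * d \<le> 1" using C(1) by (simp_all add: d_def)
        have "norm (R (\<zeta> *\<^sub>C z)) \<le> e * cmod \<zeta> ^ m" if "cmod \<zeta> < d" for \<zeta>
        proof -
          have le: "norm (\<zeta> *\<^sub>C z) \<le> cmod \<zeta>"
            using z by (simp add: norm_scaleC mult_left_le)
          have "real k * norm (R (\<zeta> *\<^sub>C z))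
              \<le> 2 * norm (\<zeta> *\<^sub>C z) ^ m + C * norm (\<zeta> *\<^sub>C z) ^ Suc m"
            using le that d by (intro C(2)) simp
          also have "\<dots> \<le> 2 * cmod \<zeta> ^ m + C * cmod \<zeta> ^ Suc m"
            using le C(1) by (intro add_mono mult_left_mono power_mono) auto
          also have "\<dots> = (2 + C * cmod \<zeta>) * cmod \<zeta> ^ m"
            by (simp add: algebra_simps)
          also have "\<dots> \<le> (2 + C * d) * cmod \<zeta> ^ m"
            using that C(1) by (intro mult_right_mono add_left_mono mult_left_mono) auto
          also have "\<dots> \<le> 3 * cmod \<zeta> ^ m"
            using d by (intro mult_right_mono) auto
          also have "\<dots> \<le> real k * e * cmod \<zeta> ^ m"
            using k e by (intro mult_right_mono) (auto simp: field_simps)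
          finally show ?thesis using \<open>0 < k\<close> by (simp add: mult.assoc)
        qed
        then show "\<forall>\<^sub>F \<zeta> in at 0. norm (R (\<zeta> *\<^sub>C z)) \<le> e * cmod \<zeta> ^ m"
          unfolding eventually_at using d by (intro exI[of _ d]) auto
      qed
    qed
  qed
  have "(\<lambda>m. 2 * norm z ^ m) \<longlonglongrightarrow> 2 * 0"
    using z by (intro tendsto_mult_left LIMSEQ_power_zero) simp
  then have "norm (R z) \<le> 0"
    using R_order z by (intro LIMSEQ_le_const[where X = "\<lambda>m. 2 * norm z ^ m"]) auto
  then show ?thesis by (simp add: R_def)
qed

section \<open>Finite-rank operators\<close>

lemma in_cspan_exchange:
  fixes w :: "'a::complex_normed_vector"
  assumes "finite B" "w \<in> cspan B" "w \<noteq> 0"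
  shows "\<exists>b\<in>B. b \<in> cspan (insert w (B - {b}))"
  using assms
proof (induction B rule: finite_induct)
  case (insert b B)
  show ?case
  proof (cases "w \<in> cspan B")
    case True
    then obtain b' where b': "b' \<in> B" "b' \<in> cspan (insert w (B - {b'}))"
      using insert by blast
    have "cspan (insert w (B - {b'})) \<subseteq> cspan (insert w (insert b B - {b'}))"
      by (intro complex_vector.span_mono) auto
    then show ?thesis using b' by blast
  next
    case False
    then have "b \<in> cspan (insert w B)"
      using complex_vector.in_span_insert insert.prems(1) by blast
    then show ?thesis using insert.hyps(2) by simp
  qed
qed simp

text \<open>Splitting off a one-dimensional piece \<open>s \<circ> T\<close> times \<open>w\<close>, with \<open>w\<close> in the range of \<open>T\<close> and
  \<open>s w = 1\<close>, leaves an operator whose range lies in the span of the images of the remaining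
  generators under the projection \<open>v \<mapsto> v - s v w\<close>, which kills \<open>w\<close>.\<close>

lemma finite_rank_decomposition:
  fixes T :: "'a::complex_normed_vector \<Rightarrow> 'b::complex_normed_vector"
  assumes "clinear T" "bounded_linear T" "finite B" "card B \<le> n" "range T \<subseteq> cspan B"
  shows "\<exists>t w. (\<forall>i<n. clinear (t i) \<and> bounded_linear (t i :: 'a \<Rightarrow> complex)) \<and>
    (\<forall>y. T y = (\<Sum>i<n. t i y *\<^sub>C w i))"
  using assms
proof (induction n arbitrary: T B)
  case 0
  then have "T y = 0" for y by auto
  then show ?case by simp
next
  case (Suc n)
  show ?case
  proof (cases "\<forall>y. T y = 0")
    case True
    then show ?thesis
      by (intro exI[of _ "\<lambda>_ _. 0"] exI[of _ "\<lambda>_. 0"]) (simp add: clinear_iff bounded_linear_zero)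
  next
    case False
    then obtain y0 where y0: "T y0 \<noteq> 0" by blast
    define w where "w = T y0"
    have w: "w \<noteq> 0" "w \<in> cspan B" using y0 Suc.prems(5) by (auto simp: w_def)
    obtain b where b: "b \<in> B" "b \<in> cspan (insert w (B - {b}))"
      using in_cspan_exchange[OF Suc.prems(3) w(2,1)] by blast
    obtain l where l: "l \<in> dual_ball" "l w = complex_of_real (norm w)"
      using norming_functional by blast
    define s where "s v = inverse (complex_of_real (norm w)) * l v" for v
    have s1: "s w = 1" using w(1) l(2) by (simp add: s_def)
    have s_add: "s (v + v') = s v + s v'" and s_scale: "s (c *\<^sub>C v) = c * s v" for v v' c
      by (simp_all add: s_def dual_ball_add[OF l(1)] dual_ball_scaleC[OF l(1)] distrib_left)
    have T_add: "T (y + y') = T y + T y'" and T_scale: "T (c *\<^sub>C y) = c *\<^sub>C T y" for y y' c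
      using Suc.prems(1) by (simp_all add: clinear_iff)
    define q where "q v = v - s v *\<^sub>C w" for v
    have q_add: "q (v + v') = q v + q v'" for v v'
      by (simp add: q_def s_add scaleC_add_left)
    have q_scale: "q (c *\<^sub>C v) = c *\<^sub>C q v" for c v
      by (simp add: q_def s_scale complex_vector.scale_right_diff_distrib)
    let ?V = "cspan (q ` (B - {b}))"
    have "complex_vector.subspace {v. q v \<in> ?V}"
      unfolding complex_vector.subspace_def
      using q_scale[of 0 0] by (auto simp: q_add q_scale complex_vector.span_add
          complex_vector.span_scale complex_vector.span_zero)
    moreover have "insert w (B - {b}) \<subseteq> {v. q v \<in> ?V}"
      by (auto simp: complex_vector.span_base complex_vector.span_zero)
         (simp add: q_def s1 complex_vector.span_zero)
    ultimately have qV: "cspan (insert w (B - {b})) \<subseteq> {v. q v \<in> ?V}"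
      by (intro complex_vector.span_minimal)
    have "B \<subseteq> cspan (insert w (B - {b}))"
      using b(2) complex_vector.span_superset[of "insert w (B - {b})"] by blast
    then have "cspan B \<subseteq> cspan (insert w (B - {b}))"
      by (intro complex_vector.span_minimal complex_vector.subspace_span)
    then have rq: "range (\<lambda>y. q (T y)) \<subseteq> ?V"
      using qV Suc.prems(5) by blast
    have cq: "clinear (\<lambda>y. q (T y))"
      by (simp add: clinear_iff q_add q_scale T_add T_scale)
    have csT: "clinear (\<lambda>y. s (T y))"
      by (simp add: clinear_iff s_add s_scale T_add T_scale scaleC_complex_def)
    have bsT: "bounded_linear (\<lambda>y. s (T y))"
      unfolding s_def
      by (intro bounded_linear_compose[OF bounded_linear_mult_right]
          bounded_linear_compose[OF dual_ball_bounded_linear[OF l(1)]] Suc.prems(2))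
    have "bounded_linear (\<lambda>c. c *\<^sub>C w)"
      by (rule clinear_imp_bounded_linear[where K = "norm w"])
        (simp_all add: clinear_iff scaleC_add_left scaleC_complex_def norm_scaleC mult.commute)
    from bounded_linear_compose[OF this bsT]
    have bq: "bounded_linear (\<lambda>y. q (T y))"
      unfolding q_def by (intro bounded_linear_sub Suc.prems(2))
    have fin: "finite (q ` (B - {b}))" using Suc.prems(3) by simp
    have "card (q ` (B - {b})) \<le> card (B - {b})"
      using Suc.prems(3) by (intro card_image_le) simp
    also have "\<dots> \<le> n"
      using Suc.prems(3,4) b(1) by (simp add: card_Diff_singleton)
    finally obtain t' w' where t': "\<And>i. i < n \<Longrightarrow> clinear (t' i) \<and> bounded_linear (t' i :: 'a \<Rightarrow> complex)"
      "\<And>y. q (T y) = (\<Sum>i<n. t' i y *\<^sub>C w' i)"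
      using Suc.IH[OF cq bq fin _ rq] by blast
    show ?thesis
    proof (intro exI conjI allI impI)
      fix i assume "i < Suc n"
      then show "clinear ((\<lambda>i. if i < n then t' i else (\<lambda>y. s (T y))) i)"
        "bounded_linear ((\<lambda>i. if i < n then t' i else (\<lambda>y. s (T y))) i)"
        using t'(1) csT bsT by auto
    next
      fix y
      have "T y = q (T y) + s (T y) *\<^sub>C w"
        by (simp add: q_def)
      then show "T y = (\<Sum>i<Suc n. (\<lambda>i. if i < n then t' i else (\<lambda>y. s (T y))) i y *\<^sub>C
          (\<lambda>i. if i < n then w' i else w) i)"
        by (simp add: t'(2))
    qed
  qed
qed

section \<open>Functionals and products as elements of the function space\<close>

lemma hl0_of_clinear:
  fixes l :: "'a::complex_normed_vector \<Rightarrow> 'b::complex_normed_vector"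
  assumes l: "clinear l" "\<And>v. norm (l v) \<le> C * norm v" and C: "0 \<le> C"
  shows "x \<in> ball 0 1 \<Longrightarrow> hl0_apply (hl0_of l) x = l x" and "norm (hl0_of l) \<le> C"
proof -
  have diff: "l (x - y) = l x - l y" for x y
    by (rule linear_diff[OF clinear_imp_linear[OF l(1)]])
  have lip: "C-lipschitz_on (ball 0 1) l"
    using l(2) C by (auto intro!: lipschitz_onI simp: dist_norm simp flip: diff)
  have hol: "l cholomorphic_on ball 0 1"
    by (intro cholomorphic_on_linear clinear_imp_bounded_linear[OF l] l(1))
  have "l 0 = 0" by (rule linear_0[OF clinear_imp_linear[OF l(1)]])
  with hol lip show "x \<in> ball 0 1 \<Longrightarrow> hl0_apply (hl0_of l) x = l x" "norm (hl0_of l) \<le> C"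
    by (simp_all add: hl0_apply_hl0_of norm_hl0_of_le)
qed

lemma hl0_of_dual_ball:
  assumes "l \<in> dual_ball"
  shows "x \<in> ball 0 1 \<Longrightarrow> hl0_apply (hl0_of l) x = l x" and "norm (hl0_of l) \<le> 1"
  using assms hl0_of_clinear[of l 1] by (auto simp: dual_ball_def)

lemma hl0_of_bounded_linear:
  assumes "clinear l" "bounded_linear l" "x \<in> ball 0 1"
  shows "hl0_apply (hl0_of l) x = l x"
  using hl0_of_clinear(1)[OF assms(1) _ _ assms(3), of "onorm l"] onorm[OF assms(2)]
    onorm_pos_le[OF assms(2)] by (simp add: mult.commute)

lemma hl0_apply_sum: "hl0_apply (\<Sum>i\<in>A. f i) x = (\<Sum>i\<in>A. hl0_apply (f i) x)"
  by (induction A rule: infinite_finite_induct) (simp_all add: plus_hl0.rep_eq zero_hl0.rep_eq)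

text \<open>Lipschitz functions on the unit ball are bounded, so their products are Lipschitz.\<close>

lemma hl0_mult:
  fixes f g :: "('a::complex_normed_vector, complex) hl0"
  obtains h :: "('a, complex) hl0"
  where "\<And>x. x \<in> ball 0 1 \<Longrightarrow> hl0_apply h x = hl0_apply f x * hl0_apply g x"
proof -
  let ?p = "\<lambda>x. hl0_apply f x * hl0_apply g x"
  have le: "cmod (hl0_apply k x) \<le> norm k" if "x \<in> ball 0 1" for k :: "('a, complex) hl0" and x
  proof -
    have "norm k * norm x \<le> norm k" using that by (simp add: mult_left_le)
    then show ?thesis using norm_hl0_apply_le[of k x] by linarith
  qed
  have "?p cholomorphic_on ball 0 1"
    unfolding cholomorphic_on_def
  proof
    fix x :: 'a assume x: "x \<in> ball 0 1"
    obtain D where D: "clinear D" "(hl0_apply f has_derivative D) (at x)"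
      by (rule hl0_apply_has_derivative[OF x])
    obtain E where E: "clinear E" "(hl0_apply g has_derivative E) (at x)"
      by (rule hl0_apply_has_derivative[OF x])
    have "clinear (\<lambda>h. hl0_apply f x * E h + D h * hl0_apply g x)"
      using D(1) E(1) by (simp add: clinear_iff scaleC_complex_def algebra_simps)
    then show "\<exists>D. clinear D \<and> (?p has_derivative D) (at x within ball 0 1)"
      using has_derivative_at_withinI[OF has_derivative_mult[OF D(2) E(2)]] by blast
  qed
  moreover have "(2 * norm f * norm g)-lipschitz_on (ball 0 1) ?p"
  proof (rule lipschitz_onI)
    fix x y :: 'a assume xy: "x \<in> ball 0 1" "y \<in> ball 0 1"
    have "?p x - ?p y = hl0_apply f x * (hl0_apply g x - hl0_apply g y)
        + (hl0_apply f x - hl0_apply f y) * hl0_apply g y"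
      by (simp add: algebra_simps)
    also have "cmod \<dots> \<le> norm f * (norm g * norm (x - y)) + norm f * norm (x - y) * norm g"
      by (intro norm_triangle_le add_mono order_trans[OF norm_mult_ineq] mult_mono le
          norm_hl0_apply_diff_le xy) simp_all
    finally show "dist (?p x) (?p y) \<le> 2 * norm f * norm g * dist x y"
      by (simp add: dist_norm algebra_simps)
  qed simp
  ultimately show thesis
    using that[of "hl0_of ?p"] by (simp add: hl0_apply_hl0_of hl0_apply_0)
qed

lemma hl0_power:
  fixes f :: "('a::complex_normed_vector, complex) hl0"
  shows "\<exists>h :: ('a, complex) hl0. \<forall>x\<in>ball 0 1. hl0_apply h x = hl0_apply f x ^ Suc n"
proof (induction n)
  case (Suc n)
  then obtain h :: "('a, complex) hl0" where h: "\<And>x. x \<in> ball 0 1 \<Longrightarrow> hl0_apply h x = hl0_apply f x ^ Suc n"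
    by blast
  obtain k :: "('a, complex) hl0" where "\<And>x. x \<in> ball 0 1 \<Longrightarrow> hl0_apply k x = hl0_apply f x * hl0_apply h x"
    using hl0_mult by blast
  with h show ?case by (intro exI[of _ k]) simp
qed (intro exI[of _ f], simp)

text \<open>A functional of norm at most one is bounded by \<open>1\<close> on the unit ball, so the Lipschitz
  constants of its powers grow only linearly, which is invisible after taking \<open>n\<close>-th roots.\<close>

lemma hl0_dual_ball_power:
  assumes l: "l \<in> dual_ball"
  obtains h :: "('a::complex_normed_vector, complex) hl0"
  where "norm h \<le> real (Suc n)" "\<And>x. x \<in> ball 0 1 \<Longrightarrow> hl0_apply h x = l x ^ Suc n"
proof -
  obtain h :: "('a, complex) hl0" where "\<And>x. x \<in> ball 0 1 \<Longrightarrow> hl0_apply h x = hl0_apply (hl0_of l) x ^ Suc n"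
    using hl0_power[of "hl0_of l" n] by blast
  then have h: "hl0_apply h x = l x ^ Suc n" if "x \<in> ball 0 1" for x
    using that by (simp add: hl0_of_dual_ball[OF l])
  have "norm h \<le> real (Suc n)"
  proof (rule norm_hl0_le, rule lipschitz_onI)
    fix x y :: 'a assume xy: "x \<in> ball 0 1" "y \<in> ball 0 1"
    have "cmod (l x) \<le> 1" "cmod (l y) \<le> 1"
      using dual_ball_norm[OF l, of x] dual_ball_norm[OF l, of y] xy by simp_all
    then have "cmod (l x ^ Suc n - l y ^ Suc n) \<le> real (Suc n) * cmod (l x - l y)"
      by (rule norm_power_diff)
    also have "\<dots> \<le> real (Suc n) * norm (x - y)"
      using dual_ball_norm[OF l, of "x - y"] by (intro mult_left_mono) (simp_all add: dual_ball_diff[OF l])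
    finally show "dist (hl0_apply h x) (hl0_apply h y) \<le> real (Suc n) * dist x y"
      unfolding dist_norm h[OF xy(1)] h[OF xy(2)] .
  qed simp
  then show thesis using h by (rule that)
qed

section \<open>Inverting a composition operator\<close>

lemma clinear_composition_operator:
  fixes \<phi> :: "('b::complex_normed_vector, 'a::complex_normed_vector) hl0"
  assumes "hl0_apply \<phi> ` ball 0 1 \<subseteq> ball 0 1"
  shows "clinear (composition_operator \<phi>)"
  unfolding clinear_iff
proof (intro conjI allI)
  fix f g :: "('a, complex) hl0" and c :: complex
  note app = hl0_apply_composition_operator[OF assms]
  show "composition_operator \<phi> (f + g) = composition_operator \<phi> f + composition_operator \<phi> g"
    by (rule hl0_eqI) (simp add: app plus_hl0.rep_eq)
  show "composition_operator \<phi> (c *\<^sub>C f) = c *\<^sub>C composition_operator \<phi> f"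
    by (rule hl0_eqI) (simp add: app scaleC_hl0.rep_eq)
qed

lemma continuous_clinear_imp_bounded:
  fixes S :: "'a::complex_normed_vector \<Rightarrow> 'b::complex_normed_vector"
  assumes S: "clinear S" and cont: "continuous_on UNIV S"
  obtains K where "0 < K" "\<And>f. norm (S f) \<le> K * norm f"
proof -
  have S0: "S 0 = 0" by (rule linear_0[OF clinear_imp_linear[OF S]])
  obtain d where d: "0 < d" "\<And>f. norm f < d \<Longrightarrow> norm (S f) < 1"
    using cont S0 unfolding continuous_on_iff dist_norm by (metis UNIV_I diff_zero zero_less_one)
  have "norm (S f) \<le> 2 / d * norm f" for f
  proof (cases "f = 0")
    case False
    define r where "r = d / (2 * norm f)"
    have r: "0 < r" using d(1) False by (simp add: r_def)
    have "norm (r *\<^sub>R f) < d" using d(1) False by (simp add: r_def)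
    from d(2)[OF this] have "r * norm (S f) < 1"
      using r by (simp add: clinear_scaleR[OF S])
    then show ?thesis using d(1) False by (simp add: r_def field_simps)
  qed (simp add: S0)
  then show thesis using d(1) by (intro that[of "2 / d"]) simp
qed

text \<open>Here the approximation property enters. For fixed \<open>x\<close>, lemma \<open>hl0_small_on_finite_set\<close> makes
  the functional \<open>u: l \<mapsto> S l x\<close> on the dual almost insensitive to replacing \<open>l\<close> by \<open>l \<circ> T\<close>, when
  \<open>T\<close> is a finite-rank operator close to the identity on a suitable finite set; and \<open>u (l \<circ> T)\<close>
  is the value of \<open>l\<close> at a point, as \<open>T\<close> has finite rank. Since the estimate is uniform over the
  dual unit ball, these points converge in norm.\<close>

lemma evaluation_point_exists:
  fixes \<phi> :: "('b::complex_banach, 'a::complex_normed_vector) hl0"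
    and S :: "('b, complex) hl0 \<Rightarrow> ('a, complex) hl0"
  assumes bap: "bounded_approximation_property TYPE('b)"
    and S: "clinear S" and K: "0 < K" "\<And>f. norm (S f) \<le> K * norm f"
    and inv: "\<And>f y. y \<in> ball 0 1 \<Longrightarrow> hl0_apply (S f) (hl0_apply \<phi> y) = hl0_apply f y"
    and unique: "\<And>g :: ('a, complex) hl0.
      (\<And>y. y \<in> ball 0 1 \<Longrightarrow> hl0_apply g (hl0_apply \<phi> y) = 0) \<Longrightarrow> g = 0"
  shows "\<exists>y. \<forall>l\<in>dual_ball. l y = hl0_apply (S (hl0_of l)) x"
proof -
  define u where "u l = hl0_apply (S (hl0_of l)) x" for l
  obtain c where c: "0 < c" and approximation: "\<forall>K :: 'b set. compact K \<longrightarrow> (\<forall>e>0.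
      \<exists>T. finite_rank_operator T \<and> onorm T \<le> c \<and> (\<forall>x\<in>K. norm (T x - x) < e))"
    using bap unfolding bounded_approximation_property_def by blast
  have S_sum: "S (\<Sum>i<n. a i *\<^sub>C f i) = (\<Sum>i<n. a i *\<^sub>C S (f i))"
    for n :: nat and a f
    using S by (simp add: linear_sum[OF clinear_imp_linear[OF S]] clinear_iff)
  have approx: "\<exists>y. \<forall>l\<in>dual_ball. cmod (u l - l y) \<le> e" if e: "0 < e" for e
  proof -
    have unique': "hl0_apply g x = 0"
      if "\<And>p. p \<in> hl0_apply \<phi> ` ball 0 1 \<Longrightarrow> hl0_apply g p = 0" for g :: "('a, complex) hl0"
      using unique[of g] that by (simp add: zero_hl0.rep_eq)
    have Kc: "0 \<le> K * (1 + c)" using K(1) c by simp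
    obtain F d
      where F: "finite F" "F \<subseteq> hl0_apply \<phi> ` ball 0 1" and d: "0 < d"
        and small: "\<forall>g :: ('a, complex) hl0. norm g \<le> K * (1 + c) \<longrightarrow>
          (\<forall>p\<in>F. cmod (hl0_apply g p) \<le> d) \<longrightarrow> cmod (hl0_apply g x) < e"
      by (rule hl0_small_on_finite_set[OF Kc e unique'])
    obtain G where G: "G \<subseteq> ball 0 1" "finite G" "F = hl0_apply \<phi> ` G"
      using finite_subset_image[OF F] by blast
    obtain T :: "'b \<Rightarrow> 'b" where T: "finite_rank_operator T" "onorm T \<le> c"
        "\<forall>y\<in>G. norm (T y - y) < d"
      using approximation[rule_format, OF finite_imp_compact[OF G(2)] d] by blast
    have bT: "bounded_linear T" and cT: "clinear T"
      using T(1) by (simp_all add: finite_rank_operator_def)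
    have nT: "norm (T y) \<le> c * norm y" for y
      using onorm[OF bT, of y] T(2) by (meson mult_right_mono norm_ge_zero order_trans)
    obtain B where "finite B" "range T \<subseteq> cspan B"
      using T(1) unfolding finite_rank_operator_def by blast
    from finite_rank_decomposition[OF cT bT this(1) order_refl this(2)]
    obtain t w where tw: "\<forall>i<card B. clinear (t i) \<and> bounded_linear (t i)"
      "\<forall>y. T y = (\<Sum>i<card B. t i y *\<^sub>C w i)"
      by (elim exE conjE)
    have "cmod (u l - l (\<Sum>i<card B. u (t i) *\<^sub>C w i)) \<le> e" if l: "l \<in> dual_ball" for l
    proof -
      have lsum: "l (\<Sum>i<card B. a i *\<^sub>C w i) = (\<Sum>i<card B. l (w i) * a i)" for a
        by (simp only: linear_sum[OF bounded_linear.linear[OF dual_ball_bounded_linear[OF l]]]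
            dual_ball_scaleC[OF l] mult.commute)
      define m where "m = hl0_of (\<lambda>y. l (T y))"
      have clT: "clinear (\<lambda>y. l (T y))"
        using cT l by (simp add: dual_ball_def clinear_iff)
      have lT: "cmod (l (T y)) \<le> c * norm y" for y
        using dual_ball_norm[OF l] nT order_trans by blast
      have m: "y \<in> ball 0 1 \<Longrightarrow> hl0_apply m y = l (T y)" "norm m \<le> c" for y
        unfolding m_def using hl0_of_clinear[OF clT lT] c by auto
      have "m = (\<Sum>i<card B. l (w i) *\<^sub>C hl0_of (t i))"
      proof (rule hl0_eqI)
        fix y :: 'b assume y: "y \<in> ball 0 1"
        have "hl0_apply (\<Sum>i<card B. l (w i) *\<^sub>C hl0_of (t i)) y = (\<Sum>i<card B. l (w i) * t i y)"
          unfolding hl0_apply_sum scaleC_hl0.rep_eq scaleC_complex_def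
          by (intro sum.cong refl) (use tw(1) y hl0_of_bounded_linear in auto)
        also have "\<dots> = l (T y)" by (simp add: tw(2)[rule_format] lsum)
        finally show "hl0_apply m y = hl0_apply (\<Sum>i<card B. l (w i) *\<^sub>C hl0_of (t i)) y"
          by (simp only: m(1)[OF y])
      qed
      then have um: "hl0_apply (S m) x = l (\<Sum>i<card B. u (t i) *\<^sub>C w i)"
        by (simp add: S_sum hl0_apply_sum scaleC_hl0.rep_eq scaleC_complex_def lsum u_def)
      have "cmod (hl0_apply (S (hl0_of l - m)) x) < e"
      proof (rule small[rule_format])
        have "norm (hl0_of l - m) \<le> 1 + c"
          using norm_triangle_ineq4[of "hl0_of l" m] hl0_of_dual_ball(2)[OF l] m(2) by linarith
        then show "norm (S (hl0_of l - m)) \<le> K * (1 + c)"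
          using K by (meson mult_left_mono less_imp_le order_trans)
        fix p assume "p \<in> F"
        then obtain y where y: "y \<in> G" "p = hl0_apply \<phi> y" "y \<in> ball 0 1" using G by blast
        have "hl0_apply (S (hl0_of l - m)) p = l y - l (T y)"
          using y(3) by (simp add: y(2) inv minus_hl0.rep_eq m(1) hl0_of_dual_ball[OF l])
        also have "\<dots> = l (y - T y)" by (simp add: dual_ball_diff[OF l])
        also have "cmod \<dots> \<le> norm (y - T y)" by (rule dual_ball_norm[OF l])
        finally show "cmod (hl0_apply (S (hl0_of l - m)) p) \<le> d"
          using T(3)[rule_format, OF y(1)] by (simp add: norm_minus_commute)
      qed
      moreover have "S (hl0_of l - m) = S (hl0_of l) - S m"
        by (rule linear_diff[OF clinear_imp_linear[OF S]])
      ultimately show ?thesis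
        by (simp add: minus_hl0.rep_eq um u_def)
    qed
    then show ?thesis by blast
  qed
  have "\<exists>y. \<forall>l\<in>dual_ball. cmod (u l - l y) \<le> 1 / real (Suc n)" for n
    by (rule approx) simp
  then obtain y where y: "\<And>n l. l \<in> dual_ball \<Longrightarrow> cmod (u l - l (y n)) \<le> 1 / real (Suc n)"
    by metis
  have lim0: "(\<lambda>n. 1 / real (Suc n)) \<longlonglongrightarrow> 0"
    by (rule LIMSEQ_Suc[OF lim_const_over_n])
  have yy: "norm (y n - y m) \<le> 1 / real (Suc n) + 1 / real (Suc m)" for n m
  proof (rule norm_le_dual_ball)
    fix l :: "'b \<Rightarrow> complex" assume l: "l \<in> dual_ball"
    have "l (y n - y m) = (u l - l (y m)) - (u l - l (y n))"
      by (simp add: dual_ball_diff[OF l])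
    also have "cmod \<dots> \<le> cmod (u l - l (y m)) + cmod (u l - l (y n))"
      by (rule norm_triangle_ineq4)
    also have "\<dots> \<le> 1 / real (Suc m) + 1 / real (Suc n)"
      by (intro add_mono y l)
    finally show "cmod (l (y n - y m)) \<le> 1 / real (Suc n) + 1 / real (Suc m)"
      by (simp only: add.commute)
  qed
  have "Cauchy y"
  proof (rule CauchyI)
    fix e :: real assume "0 < e"
    then have "\<forall>\<^sub>F n in sequentially. 1 / real (Suc n) < e / 2"
      using order_tendstoD(2)[OF lim0, of "e / 2"] by simp
    then obtain N where N: "\<And>n. n \<ge> N \<Longrightarrow> 1 / real (Suc n) < e / 2"
      unfolding eventually_sequentially by blast
    have "norm (y m - y n) < e" if "m \<ge> N" "n \<ge> N" for m n
      using yy[of m n] N[OF that(1)] N[OF that(2)] by linarith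
    then show "\<exists>N. \<forall>m\<ge>N. \<forall>n\<ge>N. norm (y m - y n) < e" by blast
  qed
  then obtain y' where y': "y \<longlonglongrightarrow> y'"
    by (auto simp: Cauchy_convergent_iff convergent_def)
  have "l y' = u l" if l: "l \<in> dual_ball" for l
  proof (rule LIMSEQ_unique)
    show "(\<lambda>n. l (y n)) \<longlonglongrightarrow> l y'"
      by (rule bounded_linear.tendsto[OF dual_ball_bounded_linear[OF l] y'])
    have "(\<lambda>n. u l - l (y n)) \<longlonglongrightarrow> 0"
      by (rule Lim_null_comparison[OF always_eventually lim0]) (use y[OF l] in blast)
    then have "(\<lambda>n. u l - (u l - l (y n))) \<longlonglongrightarrow> u l - 0"
      by (intro tendsto_intros)
    then show "(\<lambda>n. l (y n)) \<longlonglongrightarrow> u l" by simp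
  qed
  then show ?thesis unfolding u_def by blast
qed

lemma power_linear_growth_imp_le_1:
  fixes a C :: real
  assumes "0 \<le> a" and growth: "\<And>n. a ^ Suc n \<le> C * real (Suc n)"
  shows "a \<le> 1"
proof (rule ccontr)
  assume "\<not> a \<le> 1"
  then have a: "1 < a" by simp
  have "(\<lambda>n. real n * inverse a ^ n) \<longlonglongrightarrow> 0"
    using a by (intro powser_times_n_limit_0) (simp add: field_simps)
  from LIMSEQ_Suc[OF tendsto_mult_left[OF this, of C]]
  have "(\<lambda>n. C * (real (Suc n) * inverse a ^ Suc n)) \<longlonglongrightarrow> 0" by simp
  moreover have "1 \<le> C * (real (Suc n) * inverse a ^ Suc n)" for n
  proof -
    have "a ^ Suc n * inverse a ^ Suc n \<le> C * real (Suc n) * inverse a ^ Suc n"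
      using growth a by (intro mult_right_mono) auto
    moreover have "a ^ Suc n * inverse a ^ Suc n = 1"
      unfolding power_mult_distrib[symmetric] using a by simp
    ultimately show ?thesis by (simp only: mult.assoc)
  qed
  ultimately have "1 \<le> (0::real)"
    by (intro LIMSEQ_le_const) auto
  then show False by simp
qed

text \<open>The evaluation points form a map \<open>\<psi>\<close> with \<open>l \<circ> \<psi> = S l\<close> for all functionals \<open>l\<close>, where \<open>S\<close> is
  the inverse of the composition operator \<open>C\<close>; thus \<open>\<psi>\<close> is weakly holomorphic, hence
  holomorphic, and \<open>\<psi> \<circ> \<phi>\<close> is the identity. Since \<open>S\<close> is multiplicative,
  \<open>\<bar>S l x\<bar>\<^sup>n = \<bar>S (l\<^sup>n) x\<bar>\<close> grows at most linearly in \<open>n\<close> for \<open>\<parallel>l\<parallel> \<le> 1\<close>, so \<open>\<bar>S l\<bar> \<le> 1\<close> although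
  \<open>S\<close> is only bounded, and the Schwarz lemma yields \<open>\<parallel>\<psi> x\<parallel> \<le> \<parallel>x\<parallel> < 1\<close>. Finally \<open>l \<circ> \<phi> \<circ> \<psi>\<close> and \<open>l\<close>
  have the same image under the injective operator \<open>C\<close>, so \<open>\<phi> \<circ> \<psi>\<close> is the identity as well.\<close>

lemma onto_isomorphism_imp_inverse_symbol:
  fixes \<phi> :: "('b::complex_banach, 'a::complex_banach) hl0"
  assumes bap: "bounded_approximation_property TYPE('b)"
    and self: "hl0_apply \<phi> ` ball 0 1 \<subseteq> ball 0 1"
    and iso: "onto_isomorphism (composition_operator \<phi>)"
  obtains \<psi> :: "('a, 'b) hl0" where "\<And>x. x \<in> ball 0 1 \<Longrightarrow> hl0_apply \<psi> x \<in> ball 0 1"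
    "\<And>x. x \<in> ball 0 1 \<Longrightarrow> hl0_apply \<phi> (hl0_apply \<psi> x) = x"
    "\<And>y. y \<in> ball 0 1 \<Longrightarrow> hl0_apply \<psi> (hl0_apply \<phi> y) = y"
proof -
  let ?C = "composition_operator \<phi>"
  have app: "hl0_apply (?C f) y = hl0_apply f (hl0_apply \<phi> y)" for f y
    by (simp add: hl0_apply_composition_operator[OF self])
  have \<phi>_in: "hl0_apply \<phi> y \<in> ball 0 1" if "y \<in> ball 0 1" for y
    using self that by blast
  obtain S where "homeomorphism UNIV UNIV ?C S" and C: "clinear ?C"
    using iso unfolding onto_isomorphism_def by blast
  then have S: "?C (S f) = f" "S (?C g) = g" "continuous_on UNIV S" for f g
    unfolding homeomorphism_def by auto
  have inj: "g = g'" if "\<And>y. y \<in> ball 0 1 \<Longrightarrow> hl0_apply g (hl0_apply \<phi> y) = hl0_apply g' (hl0_apply \<phi> y)"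
    for g g' :: "('a, complex) hl0"
  proof -
    have "?C g = ?C g'" using that by (intro hl0_eqI) (simp add: app)
    then show ?thesis using S(2) by metis
  qed
  have inv: "hl0_apply (S f) (hl0_apply \<phi> y) = hl0_apply f y" for f y
    using app[of "S f" y] by (simp add: S(1))
  have cS: "clinear S"
    unfolding clinear_iff
  proof (intro conjI allI)
    fix f g c
    show "S (f + g) = S f + S g"
      by (rule inj) (simp add: inv plus_hl0.rep_eq)
    show "S (c *\<^sub>C f) = c *\<^sub>C S f"
      by (rule inj) (simp add: inv scaleC_hl0.rep_eq)
  qed
  obtain K where K: "0 < K" "\<And>f. norm (S f) \<le> K * norm f"
    using continuous_clinear_imp_bounded[OF cS S(3)] by blast
  have "\<exists>y. \<forall>l\<in>dual_ball. l y = hl0_apply (S (hl0_of l)) x" for x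
    by (rule evaluation_point_exists[OF bap cS K inv]) (auto intro!: inj simp: zero_hl0.rep_eq)
  then obtain \<psi> where \<psi>: "\<And>x l. l \<in> dual_ball \<Longrightarrow> l (\<psi> x) = hl0_apply (S (hl0_of l)) x"
    by metis
  have weak: "\<exists>g :: ('a, complex) hl0. norm g \<le> K \<and> (\<forall>x\<in>ball 0 1. hl0_apply g x = l (\<psi> x))"
    if l: "l \<in> dual_ball" for l
  proof (intro exI conjI ballI)
    have "K * norm (hl0_of l) \<le> K * 1"
      using K(1) by (intro mult_left_mono hl0_of_dual_ball(2) l) simp
    then show "norm (S (hl0_of l)) \<le> K"
      using K(2)[of "hl0_of l"] by linarith
  qed (simp add: \<psi>[OF l])
  have \<psi>_hol: "K-lipschitz_on (ball 0 1) \<psi>" "\<psi> cholomorphic_on ball 0 1"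
    by (rule weakly_hl0_imp_hl0, rule weak, assumption)+
  have \<psi>_le: "norm (\<psi> x) \<le> norm x" if x: "x \<in> ball 0 1" for x
  proof (rule norm_le_dual_ball)
    fix l :: "'b \<Rightarrow> complex" assume l: "l \<in> dual_ball"
    let ?g = "S (hl0_of l)"
    have "cmod (hl0_apply ?g x) \<le> 1" if x: "x \<in> ball 0 1" for x
    proof (rule power_linear_growth_imp_le_1)
      fix n
      obtain h :: "('b, complex) hl0" where h: "norm h \<le> real (Suc n)"
        "\<And>y. y \<in> ball 0 1 \<Longrightarrow> hl0_apply h y = l y ^ Suc n"
        using hl0_dual_ball_power[OF l] by blast
      obtain q :: "('a, complex) hl0" where q: "\<And>x. x \<in> ball 0 1 \<Longrightarrow> hl0_apply q x = hl0_apply ?g x ^ Suc n"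
        using hl0_power[of ?g n] by blast
      have "S h = q"
        by (rule inj) (simp only: inv h(2) q \<phi>_in hl0_of_dual_ball(1)[OF l])
      then have "cmod (hl0_apply ?g x) ^ Suc n = cmod (hl0_apply (S h) x)"
        using q[OF x] by (simp add: norm_power norm_mult)
      also have "\<dots> \<le> norm (S h) * norm x" by (rule norm_hl0_apply_le)
      also have "\<dots> \<le> norm (S h) * 1" using x by (intro mult_left_mono) auto
      also have "\<dots> \<le> K * norm h" using K(2) by simp
      also have "\<dots> \<le> K * real (Suc n)" using h(1) K(1) by (intro mult_left_mono) auto
      finally show "cmod (hl0_apply ?g x) ^ Suc n \<le> K * real (Suc n)" .
    qed simp
    from Schwarz_ball[OF cholomorphic_on_hl0_apply this hl0_apply_0 x]
    show "cmod (l (\<psi> x)) \<le> norm x"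
      by (simp add: \<psi>[OF l])
  qed
  have \<psi>_in: "\<psi> x \<in> ball 0 1" if "x \<in> ball 0 1" for x
    using \<psi>_le[OF that] that by simp
  have \<psi>0: "\<psi> 0 = 0" using \<psi>_le[of 0] by simp
  have left: "\<psi> (hl0_apply \<phi> y) = y" if y: "y \<in> ball 0 1" for y
    by (rule eq_dual_ball) (use y in \<open>simp add: \<psi> inv hl0_of_dual_ball\<close>)
  have right: "hl0_apply \<phi> (\<psi> x) = x" if x: "x \<in> ball 0 1" for x
  proof (rule eq_dual_ball)
    fix l :: "'a \<Rightarrow> complex" assume l: "l \<in> dual_ball"
    let ?f = "\<lambda>x. l (hl0_apply \<phi> (\<psi> x))"
    have f: "hl0_apply (hl0_of ?f) x = ?f x" if "x \<in> ball 0 1" for x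
    proof (rule hl0_apply_hl0_of[OF _ _ _ that])
      show "?f cholomorphic_on ball 0 1"
        by (rule cholomorphic_on_compose[OF \<psi>_hol(2)
              cholomorphic_on_dual_ball[OF cholomorphic_on_hl0_apply l]])
          (rule image_subsetI, rule \<psi>_in)
      show "(norm \<phi> * K)-lipschitz_on (ball 0 1) ?f"
      proof (rule lipschitz_onI)
        fix x y :: 'a assume xy: "x \<in> ball 0 1" "y \<in> ball 0 1"
        have "cmod (?f x - ?f y) \<le> norm (hl0_apply \<phi> (\<psi> x) - hl0_apply \<phi> (\<psi> y))"
          unfolding dual_ball_diff[OF l, symmetric] by (rule dual_ball_norm[OF l])
        also have "\<dots> \<le> norm \<phi> * norm (\<psi> x - \<psi> y)"
          by (rule norm_hl0_apply_diff_le[OF \<psi>_in[OF xy(1)] \<psi>_in[OF xy(2)]])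
        also have "\<dots> \<le> norm \<phi> * (K * norm (x - y))"
          using lipschitz_onD[OF \<psi>_hol(1) xy] by (intro mult_left_mono) (simp_all add: dist_norm)
        finally show "dist (?f x) (?f y) \<le> norm \<phi> * K * dist x y"
          by (simp add: dist_norm mult.assoc)
      qed (use K in simp)
      show "?f 0 = 0"
        using dual_ball_norm[OF l, of 0] by (simp add: \<psi>0 hl0_apply_0)
    qed
    have "hl0_of ?f = hl0_of l"
      by (rule inj) (simp only: f \<phi>_in left hl0_of_dual_ball(1)[OF l])
    then show "l (hl0_apply \<phi> (\<psi> x)) = l x"
      using f[OF x] hl0_of_dual_ball(1)[OF l x] by simp
  qed
  have "hl0_apply (hl0_of \<psi>) x = \<psi> x" if "x \<in> ball 0 1" for x
    using \<psi>_hol \<psi>0 that by (intro hl0_apply_hl0_of)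
  then show thesis
    using \<psi>_in left right \<phi>_in by (intro that[of "hl0_of \<psi>"]) auto
qed

section \<open>Biholomorphic symbols are linear isometries\<close>

lemma derivative_at_0_contraction:
  fixes f :: "'a::complex_normed_vector \<Rightarrow> 'b::complex_normed_vector"
  assumes D: "clinear D" "(f has_derivative D) (at 0)"
    and f0: "f 0 = 0" and le: "\<And>z. z \<in> ball 0 1 \<Longrightarrow> norm (f z) \<le> norm z"
  shows "norm (D h) \<le> norm h"
proof (rule field_le_epsilon)
  fix e :: real assume e: "0 < e"
  have "\<forall>\<^sub>F \<zeta> in at (0::complex). cmod \<zeta> * norm h < 1"
  proof -
    have "((\<lambda>\<zeta>::complex. cmod \<zeta> * norm h) \<longlongrightarrow> cmod 0 * norm h) (at 0)"
      by (intro tendsto_intros)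
    then show ?thesis by (rule order_tendstoD) simp
  qed
  moreover have "\<forall>\<^sub>F \<zeta> in at (0::complex). \<zeta> \<noteq> 0"
    by (simp add: eventually_at_filter)
  ultimately have "\<forall>\<^sub>F \<zeta> in at (0::complex). norm (D h) \<le> norm h + e"
    using has_derivative_remainder_line[OF D(2) e, of h]
  proof eventually_elim
    case (elim \<zeta>)
    have "norm (\<zeta> *\<^sub>C h) < 1" using elim(1) by (simp add: norm_scaleC)
    then have "norm (f (\<zeta> *\<^sub>C h)) \<le> cmod \<zeta> * norm h"
      using le[of "\<zeta> *\<^sub>C h"] by (simp add: norm_scaleC)
    moreover have "norm (D (\<zeta> *\<^sub>C h)) = cmod \<zeta> * norm (D h)"
      using D(1) by (simp add: clinear_iff norm_scaleC)
    ultimately have "cmod \<zeta> * norm (D h) \<le> cmod \<zeta> * (norm h + e)"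
      using elim(3) norm_triangle_ineq4[of "f (\<zeta> *\<^sub>C h)" "f (\<zeta> *\<^sub>C h) - D (\<zeta> *\<^sub>C h)"] f0
      by (simp add: algebra_simps)
    then show ?case using elim(2) by simp
  qed
  then show "norm (D h) \<le> norm h + e"
    by (simp add: eventually_const)
qed

text \<open>The derivatives at \<open>0\<close> of \<open>\<phi>\<close> and of its inverse are mutually inverse contractions, hence
  isometries, and Cartan's theorem applies to \<open>\<phi>\<close> followed by the inverse derivative.\<close>

lemma biholomorphic_imp_linear_isometry:
  fixes \<phi> :: "('b::complex_normed_vector, 'a::complex_normed_vector) hl0" and \<psi> :: "('a, 'b) hl0"
  assumes \<phi>_in: "\<And>y. y \<in> ball 0 1 \<Longrightarrow> hl0_apply \<phi> y \<in> ball 0 1"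
    and \<psi>_in: "\<And>x. x \<in> ball 0 1 \<Longrightarrow> hl0_apply \<psi> x \<in> ball 0 1"
    and right: "\<And>x. x \<in> ball 0 1 \<Longrightarrow> hl0_apply \<phi> (hl0_apply \<psi> x) = x"
    and left: "\<And>y. y \<in> ball 0 1 \<Longrightarrow> hl0_apply \<psi> (hl0_apply \<phi> y) = y"
  shows "\<exists>T. onto_linear_isometry T \<and> (\<forall>y\<in>ball 0 1. hl0_apply \<phi> y = T y)"
proof -
  have id_deriv: "D = (\<lambda>h. h)"
    if "(f has_derivative D) (at 0)" "\<And>z. z \<in> ball 0 1 \<Longrightarrow> f z = z"
    for f D :: "'c::complex_normed_vector \<Rightarrow> 'c"
  proof (rule has_derivative_unique[OF that(1)])
    show "(f has_derivative (\<lambda>h. h)) (at 0)"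
      by (rule has_derivative_transform_within_open[OF has_derivative_ident open_ball[of 0 1]])
        (use that(2) in simp_all)
  qed
  obtain T where T: "clinear T" "(hl0_apply \<phi> has_derivative T) (at 0)"
    by (rule hl0_apply_has_derivative[of 0]) simp
  obtain U where U: "clinear U" "(hl0_apply \<psi> has_derivative U) (at 0)"
    by (rule hl0_apply_has_derivative[of 0]) simp
  have UT: "U (T h) = h" for h
  proof -
    have "(hl0_apply \<psi> \<circ> hl0_apply \<phi> has_derivative U \<circ> T) (at 0)"
      by (rule diff_chain_at[OF T(2)]) (simp add: hl0_apply_0 U(2))
    from id_deriv[OF this] show ?thesis using left by (simp add: fun_eq_iff)
  qed
  have TU: "T (U h) = h" for h
  proof -
    have "(hl0_apply \<phi> \<circ> hl0_apply \<psi> has_derivative T \<circ> U) (at 0)"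
      by (rule diff_chain_at[OF U(2)]) (simp add: hl0_apply_0 T(2))
    from id_deriv[OF this] show ?thesis using right by (simp add: fun_eq_iff)
  qed
  have T_le: "norm (T h) \<le> norm h" for h
  proof (rule derivative_at_0_contraction[OF T hl0_apply_0])
    show "norm (hl0_apply \<phi> z) \<le> norm z" if "z \<in> ball 0 1" for z
      using Schwarz_ball[OF cholomorphic_on_hl0_apply _ hl0_apply_0 that, of \<phi> 1] \<phi>_in
      by (simp add: less_imp_le)
  qed
  have U_le: "norm (U h) \<le> norm h" for h
  proof (rule derivative_at_0_contraction[OF U hl0_apply_0])
    show "norm (hl0_apply \<psi> z) \<le> norm z" if "z \<in> ball 0 1" for z
      using Schwarz_ball[OF cholomorphic_on_hl0_apply _ hl0_apply_0 that, of \<psi> 1] \<psi>_in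
      by (simp add: less_imp_le)
  qed
  have iso: "norm (T h) = norm h" for h
    using T_le[of h] U_le[of "T h"] by (simp add: UT)
  have "surj T" using TU by (metis surjI)
  then have "onto_linear_isometry T"
    using T(1) iso by (simp add: onto_linear_isometry_def)
  moreover have "hl0_apply \<phi> y = T y" if y: "y \<in> ball 0 1" for y
  proof -
    have bU: "bounded_linear U"
      using clinear_imp_bounded_linear[OF U(1), of 1] U_le by simp
    have "U (hl0_apply \<phi> y) = y"
    proof (rule Cartan_uniqueness[where F = "\<lambda>y. U (hl0_apply \<phi> y)", OF _ _ _ _ _ y])
      show "(\<lambda>y. U (hl0_apply \<phi> y)) cholomorphic_on ball 0 1"
        by (rule cholomorphic_on_compose[OF cholomorphic_on_hl0_apply
              cholomorphic_on_linear[OF U(1) bU, of UNIV]]) simp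
      show "(norm \<phi>)-lipschitz_on (ball 0 1) (\<lambda>y. U (hl0_apply \<phi> y))"
      proof (rule lipschitz_onI)
        fix x y :: 'b assume xy: "x \<in> ball 0 1" "y \<in> ball 0 1"
        show "dist (U (hl0_apply \<phi> x)) (U (hl0_apply \<phi> y)) \<le> norm \<phi> * dist x y"
          using U_le[of "hl0_apply \<phi> x - hl0_apply \<phi> y"] norm_hl0_apply_diff_le[OF xy, of \<phi>]
          by (simp add: dist_norm linear_diff[OF clinear_imp_linear[OF U(1)]])
      qed simp
      show "(\<lambda>y. U (hl0_apply \<phi> y)) ` ball 0 1 \<subseteq> ball 0 1"
      proof (rule image_subsetI)
        fix y :: 'b assume "y \<in> ball 0 1"
        from \<phi>_in[OF this] show "U (hl0_apply \<phi> y) \<in> ball 0 1"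
          using le_less_trans[OF U_le] by simp
      qed
      show "U (hl0_apply \<phi> 0) = 0"
        by (simp add: hl0_apply_0 linear_0[OF clinear_imp_linear[OF U(1)]])
      have "((\<lambda>y. U (hl0_apply \<phi> y)) has_derivative (\<lambda>h. U (T h))) (at 0)"
        by (rule bounded_linear.has_derivative[OF bU T(2)])
      then show "((\<lambda>y. U (hl0_apply \<phi> y)) has_derivative (\<lambda>h. h)) (at 0)"
        by (simp add: UT)
    qed
    then show ?thesis using TU by metis
  qed
  ultimately show ?thesis by blast
qed

section \<open>Composition with a linear isometry\<close>

lemma onto_linear_isometry_inv:
  assumes T: "onto_linear_isometry T"
  shows "onto_linear_isometry (inv T)" "inv T (T y) = y" "T (inv T x) = x"
proof -
  have lin: "clinear T" and norm: "\<And>y. norm (T y) = norm y" and surj: "surj T"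
    using T by (auto simp: onto_linear_isometry_def)
  have "inj T"
  proof (rule injI)
    fix x y assume "T x = T y"
    then show "x = y"
      using norm[of "x - y"] linear_diff[OF clinear_imp_linear[OF lin], of x y] by simp
  qed
  then show l: "inv T (T y) = y" for y by simp
  show r: "T (inv T x) = x" for x using surj by (simp add: surj_f_inv_f)
  have "clinear (inv T)"
    unfolding clinear_iff
  proof (intro conjI allI)
    fix x y c
    show "inv T (x + y) = inv T x + inv T y" "inv T (c *\<^sub>C x) = c *\<^sub>C inv T x"
      using lin l r by (metis clinear_iff)+
  qed
  moreover have "norm (inv T x) = norm x" for x using norm[of "inv T x"] by (simp add: r)
  moreover have "surj (inv T)" using l by (metis surjI)
  ultimately show "onto_linear_isometry (inv T)"
    by (simp add: onto_linear_isometry_def)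
qed

lemma onto_linear_isometry_imp_onto_isomorphism:
  assumes T: "onto_linear_isometry T"
  shows "onto_isomorphism T"
proof -
  have cont: "continuous_on UNIV R" if "onto_linear_isometry R" for R :: "'c::complex_normed_vector \<Rightarrow> 'd::complex_normed_vector"
    using that clinear_imp_bounded_linear[of R 1]
    by (intro linear_continuous_on) (simp add: onto_linear_isometry_def)
  have "homeomorphism UNIV UNIV T (inv T)"
    using cont[OF T] cont[OF onto_linear_isometry_inv(1)[OF T]] T onto_linear_isometry_inv(1)[OF T]
      onto_linear_isometry_inv(2,3)[OF T]
    by (simp add: homeomorphism_def onto_linear_isometry_def)
  then show ?thesis
    using T by (auto simp: onto_isomorphism_def onto_linear_isometry_def)
qed

lemma hl0_of_onto_linear_isometry:
  assumes "onto_linear_isometry T"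
  shows "x \<in> ball 0 1 \<Longrightarrow> hl0_apply (hl0_of T) x = T x" "norm (hl0_of T) \<le> 1"
  using assms hl0_of_clinear[of T 1] by (auto simp: onto_linear_isometry_def)

lemma norm_composition_operator_le:
  assumes "hl0_apply \<phi> ` ball 0 1 \<subseteq> ball 0 1"
  shows "norm (composition_operator \<phi> f) \<le> norm f * norm \<phi>"
  unfolding norm_hl0.rep_eq[of "composition_operator \<phi> f"] hl0_apply_composition_operator[OF assms]
  by (intro lipschitz_const_le lipschitz_on_compose lipschitz_on_hl0_apply
      lipschitz_on_subset[OF lipschitz_on_hl0_apply assms])

lemma composition_operator_linear_isometry:
  fixes \<phi> :: "('b::complex_normed_vector, 'a::complex_normed_vector) hl0"
  assumes T: "onto_linear_isometry T" and \<phi>: "\<And>y. y \<in> ball 0 1 \<Longrightarrow> hl0_apply \<phi> y = T y"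
  shows "onto_linear_isometry (composition_operator \<phi>)"
proof -
  define \<psi> where "\<psi> = hl0_of (inv T)"
  note T' = onto_linear_isometry_inv[OF T]
  have \<psi>: "hl0_apply \<psi> x = inv T x" if "x \<in> ball 0 1" for x
    unfolding \<psi>_def by (rule hl0_of_onto_linear_isometry(1)[OF T'(1) that])
  have \<psi>_le: "norm \<psi> \<le> 1"
    unfolding \<psi>_def by (rule hl0_of_onto_linear_isometry(2)[OF T'(1)])
  have "\<phi> = hl0_of T"
    by (rule hl0_eqI) (simp only: \<phi> hl0_of_onto_linear_isometry(1)[OF T])
  then have \<phi>_le: "norm \<phi> \<le> 1" using hl0_of_onto_linear_isometry(2)[OF T] by simp
  have nT: "norm (T y) = norm y" "norm (inv T x) = norm x" for x y
    using T T'(1) by (simp_all add: onto_linear_isometry_def)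
  have \<phi>_in: "hl0_apply \<phi> ` ball 0 1 \<subseteq> ball 0 1" and \<psi>_in: "hl0_apply \<psi> ` ball 0 1 \<subseteq> ball 0 1"
    using \<phi> \<psi> nT by auto
  note app = hl0_apply_composition_operator[OF \<phi>_in] hl0_apply_composition_operator[OF \<psi>_in]
  have 1: "composition_operator \<psi> (composition_operator \<phi> f) = f" for f
    by (rule hl0_eqI) (use \<psi> \<phi> nT T' in \<open>simp add: app\<close>)
  have 2: "composition_operator \<phi> (composition_operator \<psi> f) = f" for f
    by (rule hl0_eqI) (use \<psi> \<phi> nT T' in \<open>simp add: app\<close>)
  have le: "norm (composition_operator \<phi> f) \<le> norm f" for f
    using norm_composition_operator_le[OF \<phi>_in, of f] mult_left_mono[OF \<phi>_le, of "norm f"] by simp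
  have "norm (composition_operator \<psi> f) \<le> norm f" for f
    using norm_composition_operator_le[OF \<psi>_in, of f] mult_left_mono[OF \<psi>_le, of "norm f"] by simp
  then have "norm f \<le> norm (composition_operator \<phi> f)" for f
    using 1 by metis
  with le have "norm (composition_operator \<phi> f) = norm f" for f
    by (rule order_antisym)
  moreover have "surj (composition_operator \<phi>)" using 2 by (metis surjI)
  ultimately show ?thesis
    using clinear_composition_operator[OF \<phi>_in] by (simp add: onto_linear_isometry_def)
qed

theorem corollary3p16:
  fixes \<phi> :: "('b::complex_banach, 'a::complex_banach) hl0"
  assumes "bounded_approximation_property TYPE('b)"
    and "hl0_apply \<phi> ` ball 0 1 \<subseteq> ball 0 1"
  shows "(onto_linear_isometry (composition_operator \<phi>) \<longleftrightarrow>
            onto_isomorphism (composition_operator \<phi>)) \<and>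
         (onto_isomorphism (composition_operator \<phi>) \<longleftrightarrow>
            bij_betw (hl0_apply \<phi>) (ball 0 1) (ball 0 1) \<and>
            (\<exists>\<psi>::('a, 'b) hl0. \<forall>x\<in>ball 0 1.
               hl0_apply \<psi> x = inv_into (ball 0 1) (hl0_apply \<phi>) x)) \<and>
         (bij_betw (hl0_apply \<phi>) (ball 0 1) (ball 0 1) \<and>
            (\<exists>\<psi>::('a, 'b) hl0. \<forall>x\<in>ball 0 1.
               hl0_apply \<psi> x = inv_into (ball 0 1) (hl0_apply \<phi>) x) \<longleftrightarrow>
            (\<exists>T::'b \<Rightarrow> 'a. onto_linear_isometry T \<and> (\<forall>y\<in>ball 0 1. hl0_apply \<phi> y = T y)))"
    (is "(?one \<longleftrightarrow> ?two) \<and> (?two \<longleftrightarrow> ?three) \<and> (?three \<longleftrightarrow> ?four)")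
proof -
  have "?one \<Longrightarrow> ?two"
    by (rule onto_linear_isometry_imp_onto_isomorphism)
  moreover have "?two \<Longrightarrow> ?three"
  proof -
    assume ?two
    then obtain \<psi> :: "('a, 'b) hl0" where \<psi>: "\<And>x. x \<in> ball 0 1 \<Longrightarrow> hl0_apply \<psi> x \<in> ball 0 1"
      "\<And>x. x \<in> ball 0 1 \<Longrightarrow> hl0_apply \<phi> (hl0_apply \<psi> x) = x"
      "\<And>y. y \<in> ball 0 1 \<Longrightarrow> hl0_apply \<psi> (hl0_apply \<phi> y) = y"
      using onto_isomorphism_imp_inverse_symbol[OF assms] by blast
    have bij: "bij_betw (hl0_apply \<phi>) (ball 0 1) (ball 0 1)"
      using assms(2) \<psi> by (intro bij_betw_byWitness[where f' = "hl0_apply \<psi>"]) auto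
    moreover have "hl0_apply \<psi> x = inv_into (ball 0 1) (hl0_apply \<phi>) x" if "x \<in> ball 0 1" for x
      using \<psi>(1,2)[OF that] bij by (simp add: bij_betw_def inv_into_f_eq)
    ultimately show ?three by blast
  qed
  moreover have "?three \<Longrightarrow> ?four"
  proof -
    assume three: ?three
    then obtain \<psi> :: "('a, 'b) hl0"
      where \<psi>: "\<And>x. x \<in> ball 0 1 \<Longrightarrow> hl0_apply \<psi> x = inv_into (ball 0 1) (hl0_apply \<phi>) x"
      by blast
    have bij: "bij_betw (hl0_apply \<phi>) (ball 0 1) (ball 0 1)" using three by blast
    note inv = bij_betw_inv_into_left[OF bij] bij_betw_inv_into_right[OF bij]
      bij_betwE[OF bij_betw_inv_into[OF bij]]
    show ?four
      by (rule biholomorphic_imp_linear_isometry[where \<psi> = \<psi>]) (use \<psi> inv bij_betwE[OF bij] in auto)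
  qed
  moreover have "?four \<Longrightarrow> ?one"
    using composition_operator_linear_isometry by blast
  ultimately show ?thesis by blast
qed

end
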